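(* Let $T$ be a perfect tract and $M$ a matroid on a finite set $E$ with lattice of flats $\Lambda$, and let $\Lambda^{\leq2}$ be the set of flats of $M$ of corank $1$ or $2$. For every $(\Lambda^{\leq2},T)$-representation $\psi=\{\psi_F\mid F\in\Lambda^{\leq2}\}$ of $M$, there is a unique $T$-matroid $[\varphi]$ with underlying matroid $M$ such that $[\psi_F]=[\varphi_F]$ for every $F\in\Lambda^{\leq2}$. Conversely, every $T$-matroid $[\varphi]$ with underlying matroid $M_\varphi=M$ arises in this way from a $(\Lambda^{\leq2},T)$-representation $\psi$ of $M$, and $\psi$ is uniquely determined by $[\varphi]$ up to multiplying each $\psi_F$ by a scalar $a_F\in T^\times$.
   Context: A tract is a commutative monoid $(T,\cdot)$ with an element $0$ such that $0\cdot a=0$ for all $a$ and $T^\times=T\setminus\{0\}$ is an abelian group, together with $N_T\subseteq \mathbb N[T^\times]$ (elements of $T$ regarded in $\mathbb N[T^\times]$, $0$ as zero) containing $0$, closed under addition and multiplication by $\mathbb N[T^\times]$, such that each $a\in T$ has a unique $b\in T$ with $a+b\in N_T$. $X\perp Y$ for $X,Y\in T^E$ means $\sum_eX(e)Y(e)\in N_T$. A Grassmann–Plücker (GP) function of rank $r$ on finite $E$ is $\varphi:E^r\to T$ with (GP1) the set $\mathcal B_\varphi$ of $r$-sets $\{e_1,\dots,e_r\}$ with $\varphi(e_1,\dots,e_r)\ne0$ nonempty and the basis set of a matroid; (GP2) $\varphi$ alternating; (GP3) $\varphi(\underline e,a,b)\varphi(\underline e,c,d)-\varphi(\underline e,a,c)\varphi(\underline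 e,b,d)+\varphi(\underline e,a,d)\varphi(\underline e,b,c)\in N_T$ for all $\underline e\in E^{r-2}$, $a,b,c,d\in E$. Every nonzero function $E\to T$ is a GP function of rank 1. A $T$-matroid is a class $[\varphi]$ modulo $T^\times$; $M_\varphi$ is the matroid with bases $\mathcal B_\varphi$. Vector set $\mathcal V_\varphi=\{X:\sum_eX(e)\varphi(i_1,..,i_{r-1},e)\in N_T\ \forall i_j\in E\}$. Dual: with a total order on $E$, $n=|E|$, $\varphi^*(d_1,\dots,d_{n-r})=\mathrm{sign}(d_1,\dots,d_{n-r},e_1,\dots,e_r)\varphi(e_1,\dots,e_r)$ when $E=\{d_1,..,d_{n-r},e_1,..,e_r\}$ (sign of the sorting permutation), $0$ if the $d_i$ repeat; covector set $\mathcal V^*_\varphi=\mathcal V_{\varphi^*}$. $T$ is perfect if every vector is orthogonal to every covector for every $T$-matroid. For a matroid $M$ of rank $r$ on $E$ with hyperplane set $\mathcal H$: a hyperplane function for $H$ is $\eta_H:E\to T$ with support $\{e:\eta_H(e)\neq0\}=E\setminus H$. A $T$-representation of $M$ is $\eta:\mathcal H\to T^E$ with each $\eta_H$ a hyperplane function for $H$ and $\eta_{H_1},\eta_{H_2},\eta_{H_3}$ linearly dependent (i.e. $\sum_jc_j\eta_{H_j}(e)\in N_T$ for all $e$, some $c_j$ not all 0) whenever $H_1,H_2,H_3$ are pairwise distinct with corank-2 intersection; it corresponds to $[\varphi]$ if $M_\varphi=M$ and $\eta_H(d)/\eta_H(e)=\varphi(i_1,..,i_{r-1},d)/\varphi(i_1,..,i_{r-1},e)$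 for all $H$, $i_j\in H$ spanning $H$, $d,e\notin H$. Matroid quotient: $[\varphi]$ is a quotient of $[\psi]$ (both on $E$) if $\{\eta_H:H\in\mathcal H_{M_\varphi}\}\subseteq\mathcal V^*_\psi$ for a $T$-representation $\eta$ corresponding to $[\varphi]$. $F$-quotient: for a flat $F$ of $M_\varphi$ of corank $s$ and a basis $\{i_1,\dots,i_{r-s}\}$ of $F$, $\varphi_F(e_1,\dots,e_s)=\varphi(i_1,\dots,i_{r-s},e_1,\dots,e_s)$, a GP function of rank $s$ on $E$ whose class $[\varphi_F]$ depends only on $F$. A $(\Lambda^{\leq2},T)$-representation of $M$ is a family of GP functions $\psi=\{\psi_F:E^{\mathrm{cork}F}\to T\mid F\in\Lambda^{\leq2}\}$ such that ($\Lambda$R1) $\psi_H:E\to T$ is a hyperplane function for $H$ for every hyperplane $H$ of $M$; ($\Lambda$R2) $[\psi_H]$ is a matroid quotient of $[\psi_F]$ whenever $F$ is a corank-2 flat, $H$ a hyperplane, and $F\subseteq H$. *)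

theory Defs
  imports
    "HOL-Library.Multiset"
    "HOL-Library.FuncSet"
    "HOL-Combinatorics.Permutations"
begin

text \<open>
  The semiring \<open>\<nat>[T\<^sup>\<times>]\<close> is modelled by the multisets over \<open>T\<close> that do not contain \<open>0\<close>;
  \<open>formal a\<close> is the element \<open>a\<close> of \<open>T\<close> regarded in \<open>\<nat>[T\<^sup>\<times>]\<close>.
\<close>

definition (in zero) formal :: "'a \<Rightarrow> 'a multiset" where
  "formal a = (if a = 0 then {#} else {#a#})"

definition (in times) formal_times :: "'a multiset \<Rightarrow> 'a multiset \<Rightarrow> 'a multiset" where
  "formal_times A B = (\<Sum>a\<in>#A. image_mset (\<lambda>b. a * b) B)"

text \<open>
  \<open>- a\<close> names the unique \<open>b\<close> with \<open>a + b \<in> N\<^sub>T\<close>.  The value of \<open>inverse 0\<close> is left unspecified.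
\<close>

class tract = comm_monoid_mult + mult_zero + zero_neq_one + inverse + uminus +
  fixes null :: "'a multiset set"
  assumes tract_inverse: "a \<noteq> 0 \<Longrightarrow> inverse a * a = 1"
    and tract_divide: "a / b = a * inverse b"
    and null_units: "A \<in> null \<Longrightarrow> 0 \<notin># A"
    and null_empty: "{#} \<in> null"
    and null_plus: "A \<in> null \<Longrightarrow> B \<in> null \<Longrightarrow> A + B \<in> null"
    and null_times: "0 \<notin># A \<Longrightarrow> B \<in> null \<Longrightarrow> formal_times A B \<in> null"
    and null_uminus: "formal a + formal b \<in> null \<longleftrightarrow> b = - a"

definition orthogonal :: "'e set \<Rightarrow> ('e \<Rightarrow> 't::tract) \<Rightarrow> ('e \<Rightarrow> 't) \<Rightarrow> bool" where
  "orthogonal E X Y \<longleftrightarrow> (\<Sum>e\<in>E. formal (X e * Y e)) \<in> null"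

definition tract_sign :: "(nat \<Rightarrow> nat) \<Rightarrow> 't::tract" where
  "tract_sign p = (if sign p = 1 then 1 else - 1)"

definition matroid :: "'e set \<Rightarrow> 'e set set \<Rightarrow> bool" where
  "matroid E Bs \<longleftrightarrow> finite E \<and> Bs \<noteq> {} \<and> (\<forall>B\<in>Bs. B \<subseteq> E) \<and>
     (\<forall>B\<in>Bs. \<forall>B'\<in>Bs. \<forall>x\<in>B - B'. \<exists>y\<in>B' - B. insert y (B - {x}) \<in> Bs)"

definition indep :: "'e set set \<Rightarrow> 'e set \<Rightarrow> bool" where
  "indep Bs I \<longleftrightarrow> (\<exists>B\<in>Bs. I \<subseteq> B)"

definition mrank :: "'e set set \<Rightarrow> 'e set \<Rightarrow> nat" where
  "mrank Bs A = Max (card ` {I. I \<subseteq> A \<and> indep Bs I})"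

definition mclosure :: "'e set \<Rightarrow> 'e set set \<Rightarrow> 'e set \<Rightarrow> 'e set" where
  "mclosure E Bs A = {e \<in> E. mrank Bs (insert e A) = mrank Bs A}"

definition flats :: "'e set \<Rightarrow> 'e set set \<Rightarrow> 'e set set" where
  "flats E Bs = {F. F \<subseteq> E \<and> mclosure E Bs F = F}"

definition corank :: "'e set \<Rightarrow> 'e set set \<Rightarrow> 'e set \<Rightarrow> nat" where
  "corank E Bs A = mrank Bs E - mrank Bs A"

definition hyperplanes :: "'e set \<Rightarrow> 'e set set \<Rightarrow> 'e set set" where
  "hyperplanes E Bs = {H \<in> flats E Bs. corank E Bs H = 1}"

definition flats_le2 :: "'e set \<Rightarrow> 'e set set \<Rightarrow> 'e set set" where
  "flats_le2 E Bs = {F \<in> flats E Bs. corank E Bs F = 1 \<or> corank E Bs F = 2}"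

definition basis_of :: "'e set set \<Rightarrow> 'e set \<Rightarrow> 'e set \<Rightarrow> bool" where
  "basis_of Bs F I \<longleftrightarrow> I \<subseteq> F \<and> indep Bs I \<and> (\<forall>J. I \<subseteq> J \<and> J \<subseteq> F \<and> indep Bs J \<longrightarrow> J = I)"

text \<open>
  Elements of \<open>E\<^sup>r\<close> are lists, and functions on \<open>E\<^sup>r\<close> or on \<open>E\<close> are extensional, so that
  equality in HOL is equality of functions on the intended domain.
\<close>

definition tuples :: "'e set \<Rightarrow> nat \<Rightarrow> 'e list set" where
  "tuples E r = {es. length es = r \<and> set es \<subseteq> E}"

definition gp_bases :: "'e set \<Rightarrow> nat \<Rightarrow> ('e list \<Rightarrow> 't::tract) \<Rightarrow> 'e set set" where
  "gp_bases E r \<phi> = {set es |es. es \<in> tuples E r \<and> distinct es \<and> \<phi> es \<noteq> 0}"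

definition alternating :: "'e set \<Rightarrow> nat \<Rightarrow> ('e list \<Rightarrow> 't::tract) \<Rightarrow> bool" where
  "alternating E r \<phi> \<longleftrightarrow>
     (\<forall>es\<in>tuples E r. \<not> distinct es \<longrightarrow> \<phi> es = 0) \<and>
     (\<forall>es\<in>tuples E r. \<forall>p. p permutes {..<r} \<longrightarrow>
        \<phi> (permute_list p es) = tract_sign p * \<phi> es)"

definition gp_function :: "'e set \<Rightarrow> nat \<Rightarrow> ('e list \<Rightarrow> 't::tract) \<Rightarrow> bool" where
  "gp_function E r \<phi> \<longleftrightarrow>
     \<phi> \<in> tuples E r \<rightarrow>\<^sub>E UNIV \<and>
     matroid E (gp_bases E r \<phi>) \<and>
     alternating E r \<phi> \<and>
     (\<forall>es a b c d. length es + 2 = r \<and> set es \<subseteq> E \<and> {a, b, c, d} \<subseteq> E \<longrightarrow>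
        formal (\<phi> (es @ [a, b]) * \<phi> (es @ [c, d])) +
        formal (- (\<phi> (es @ [a, c]) * \<phi> (es @ [b, d]))) +
        formal (\<phi> (es @ [a, d]) * \<phi> (es @ [b, c])) \<in> null)"

definition gp_scale :: "'e set \<Rightarrow> nat \<Rightarrow> 't::tract \<Rightarrow> ('e list \<Rightarrow> 't) \<Rightarrow> 'e list \<Rightarrow> 't" where
  "gp_scale E r a \<phi> = (\<lambda>es\<in>tuples E r. a * \<phi> es)"

definition gp_class :: "'e set \<Rightarrow> nat \<Rightarrow> ('e list \<Rightarrow> 't::tract) \<Rightarrow> ('e list \<Rightarrow> 't) set" where
  "gp_class E r \<phi> = {gp_scale E r a \<phi> |a. a \<noteq> 0}"

definition vectors :: "'e set \<Rightarrow> nat \<Rightarrow> ('e list \<Rightarrow> 't::tract) \<Rightarrow> ('e \<Rightarrow> 't) set" where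
  "vectors E r \<phi> = {X \<in> E \<rightarrow>\<^sub>E UNIV.
     \<forall>is. length is + 1 = r \<and> set is \<subseteq> E \<longrightarrow> (\<Sum>e\<in>E. formal (X e * \<phi> (is @ [e]))) \<in> null}"

definition sorting_perm :: "('e \<times> 'e) set \<Rightarrow> 'e list \<Rightarrow> nat \<Rightarrow> nat" where
  "sorting_perm R xs =
     (THE p. p permutes {..<length xs} \<and> sorted_wrt (\<lambda>x y. (x, y) \<in> R) (permute_list p xs))"

text \<open>
  The order in which \<open>E - {d\<^sub>1, \<dots>}\<close> is listed is immaterial for an alternating \<open>\<phi>\<close>.
\<close>

definition gp_dual ::
  "'e set \<Rightarrow> ('e \<times> 'e) set \<Rightarrow> nat \<Rightarrow> ('e list \<Rightarrow> 't::tract) \<Rightarrow> 'e list \<Rightarrow> 't" where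
  "gp_dual E R r \<phi> = (\<lambda>ds\<in>tuples E (card E - r).
     if distinct ds
     then let es = (SOME es. distinct es \<and> set es = E - set ds)
          in tract_sign (sorting_perm R (ds @ es)) * \<phi> es
     else 0)"

text \<open>
  Another total order on \<open>E\<close> multiplies the dual by \<open>1\<close> or \<open>-1\<close>, so the covector set does not
  depend on \<open>R\<close>.
\<close>

definition covectors :: "'e set \<Rightarrow> nat \<Rightarrow> ('e list \<Rightarrow> 't::tract) \<Rightarrow> ('e \<Rightarrow> 't) set" where
  "covectors E r \<phi> =
     {Y. \<exists>R. linear_order_on E R \<and> Y \<in> vectors E (card E - r) (gp_dual E R r \<phi>)}"

text \<open>
  Every finite set is in bijection with a finite set of natural numbers, so ground sets in
  \<open>nat\<close> cover all \<open>T\<close>-matroids up to relabelling.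
\<close>

definition perfect_tract :: "'t::tract itself \<Rightarrow> bool" where
  "perfect_tract _ \<longleftrightarrow>
     (\<forall>(E :: nat set) r (\<phi> :: nat list \<Rightarrow> 't). finite E \<and> gp_function E r \<phi> \<longrightarrow>
        (\<forall>X\<in>vectors E r \<phi>. \<forall>Y\<in>covectors E r \<phi>. orthogonal E X Y))"

definition hyperplane_function :: "'e set \<Rightarrow> 'e set \<Rightarrow> ('e \<Rightarrow> 't::tract) \<Rightarrow> bool" where
  "hyperplane_function E H f \<longleftrightarrow> f \<in> E \<rightarrow>\<^sub>E UNIV \<and> {e \<in> E. f e \<noteq> 0} = E - H"

definition lin_dependent3 ::
  "'e set \<Rightarrow> ('e \<Rightarrow> 't::tract) \<Rightarrow> ('e \<Rightarrow> 't) \<Rightarrow> ('e \<Rightarrow> 't) \<Rightarrow> bool" where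
  "lin_dependent3 E f g h \<longleftrightarrow>
     (\<exists>a b c. \<not> (a = 0 \<and> b = 0 \<and> c = 0) \<and>
        (\<forall>e\<in>E. formal (a * f e) + formal (b * g e) + formal (c * h e) \<in> null))"

definition T_representation :: "'e set \<Rightarrow> 'e set set \<Rightarrow> ('e set \<Rightarrow> 'e \<Rightarrow> 't::tract) \<Rightarrow> bool" where
  "T_representation E Bs \<eta> \<longleftrightarrow>
     (\<forall>H\<in>hyperplanes E Bs. hyperplane_function E H (\<eta> H)) \<and>
     (\<forall>H1\<in>hyperplanes E Bs. \<forall>H2\<in>hyperplanes E Bs. \<forall>H3\<in>hyperplanes E Bs.
        H1 \<noteq> H2 \<and> H1 \<noteq> H3 \<and> H2 \<noteq> H3 \<and> corank E Bs (H1 \<inter> H2 \<inter> H3) = 2 \<longrightarrow>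
        lin_dependent3 E (\<eta> H1) (\<eta> H2) (\<eta> H3))"

definition corresponds ::
  "'e set \<Rightarrow> 'e set set \<Rightarrow> ('e set \<Rightarrow> 'e \<Rightarrow> 't::tract) \<Rightarrow> nat \<Rightarrow> ('e list \<Rightarrow> 't) \<Rightarrow> bool" where
  "corresponds E Bs \<eta> r \<phi> \<longleftrightarrow>
     gp_bases E r \<phi> = Bs \<and>
     (\<forall>H\<in>hyperplanes E Bs. \<forall>is. length is + 1 = r \<and> set is \<subseteq> H \<and> mclosure E Bs (set is) = H \<longrightarrow>
        (\<forall>d\<in>E - H. \<forall>e\<in>E - H. \<eta> H d / \<eta> H e = \<phi> (is @ [d]) / \<phi> (is @ [e])))"

text \<open>\<open>matroid_quotient E s \<phi> r \<psi>\<close>: the class of \<open>\<phi>\<close> (rank \<open>s\<close>) is a quotient of the class of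
  \<open>\<psi>\<close> (rank \<open>r\<close>).\<close>

definition matroid_quotient ::
  "'e set \<Rightarrow> nat \<Rightarrow> ('e list \<Rightarrow> 't::tract) \<Rightarrow> nat \<Rightarrow> ('e list \<Rightarrow> 't) \<Rightarrow> bool" where
  "matroid_quotient E s \<phi> r \<psi> \<longleftrightarrow>
     (\<exists>\<eta>. T_representation E (gp_bases E s \<phi>) \<eta> \<and>
          corresponds E (gp_bases E s \<phi>) \<eta> s \<phi> \<and>
          \<eta> ` hyperplanes E (gp_bases E s \<phi>) \<subseteq> covectors E r \<psi>)"

text \<open>\<open>\<phi>\<^sub>F\<close>, formed with an arbitrarily chosen ordered basis of \<open>F\<close>; only its class matters.\<close>

definition F_quotient ::
  "'e set \<Rightarrow> nat \<Rightarrow> ('e list \<Rightarrow> 't::tract) \<Rightarrow> 'e set \<Rightarrow> 'e list \<Rightarrow> 't" where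
  "F_quotient E r \<phi> F =
     (let Bs = gp_bases E r \<phi>;
          is = (SOME is. distinct is \<and> basis_of Bs F (set is))
      in (\<lambda>es\<in>tuples E (corank E Bs F). \<phi> (is @ es)))"

definition Lambda2_representation ::
  "'e set \<Rightarrow> 'e set set \<Rightarrow> ('e set \<Rightarrow> 'e list \<Rightarrow> 't::tract) \<Rightarrow> bool" where
  "Lambda2_representation E Bs \<psi> \<longleftrightarrow>
     (\<forall>F\<in>flats_le2 E Bs. gp_function E (corank E Bs F) (\<psi> F)) \<and>
     (\<forall>H\<in>hyperplanes E Bs. hyperplane_function E H (\<lambda>e\<in>E. \<psi> H [e])) \<and>
     (\<forall>F\<in>flats E Bs. \<forall>H\<in>hyperplanes E Bs. corank E Bs F = 2 \<and> F \<subseteq> H \<longrightarrow>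
        matroid_quotient E 1 (\<psi> H) 2 (\<psi> F))"

definition agrees_with_quotients ::
  "'e set \<Rightarrow> 'e set set \<Rightarrow> ('e set \<Rightarrow> 'e list \<Rightarrow> 't::tract) \<Rightarrow> ('e list \<Rightarrow> 't) \<Rightarrow> bool" where
  "agrees_with_quotients E Bs \<psi> \<phi> \<longleftrightarrow>
     (\<forall>F\<in>flats_le2 E Bs.
        gp_class E (corank E Bs F) (\<psi> F) =
        gp_class E (corank E Bs F) (F_quotient E (mrank Bs E) \<phi> F))"

end

theory Submission
  imports Defs
begin

text \<open>
  Covectors of a rank-two function \<open>\<psi>\<close> are the functions \<open>Y\<close> satisfying the three-term relation
  \<open>Y(a)\<psi>(b,c) - Y(b)\<psi>(a,c) + Y(c)\<psi>(a,b) \<in> N\<close>.  Hence the quotient conditions say exactly that, for a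
  flat \<open>F\<close> of corank 2, \<open>\<psi>\<^sub>F\<close> has \<open>M/F\<close> as underlying matroid and \<open>\<psi>\<^sub>F(x,\<cdot>)\<close> is a multiple of \<open>\<psi>\<^sub>H\<close>
  whenever \<open>x\<close> and \<open>F\<close> span \<open>H\<close>.

  A Grassmann-Pluecker function \<open>\<Phi>\<^sub>I\<close> of \<open>M/I\<close> is then built for every independent \<open>I\<close> by descending
  induction on \<open>|I|\<close>, with \<open>\<Phi>\<^sub>I(x,\<cdot>) = c\<^sub>x \<Phi>\<^sub>I\<^sub>x\<close>.  Writing \<open>\<Phi>\<^sub>I\<^sub>x(y,\<cdot>) = \<alpha>\<^sub>x\<^sub>y \<Phi>\<^sub>I\<^sub>x\<^sub>y\<close>, this function alternates iff
  \<open>c\<^sub>x \<alpha>\<^sub>x\<^sub>y = - c\<^sub>y \<alpha>\<^sub>y\<^sub>x\<close>, so the obstruction is a 1-cocycle on the graph of non-parallel pairs of points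
  of \<open>M/I\<close>.  It is trivial on independent triples because the \<open>\<Phi>\<^sub>I\<^sub>x\<close> alternate, hence on collinear triples
  by coning over a point off the line, which exists as \<open>M/I\<close> has rank at least 3; any two points have a
  common neighbour, so the cocycle is a coboundary.  In rank at least 3 the three-term relations of
  \<open>\<Phi>\<^sub>I\<close> are inherited from the \<open>\<Phi>\<^sub>I\<^sub>x\<close>.  The same comparison of \<open>c\<^sub>x\<close> with \<open>c\<^sub>y\<close> gives uniqueness.
\<close>

section \<open>Arithmetic in tracts\<close>

lemma tract_uminus_zero [simp]: "- (0::'t::tract) = 0"
proof -
  have "formal (0::'t) + formal 0 \<in> null"
    by (simp add: formal_def null_empty)
  thus ?thesis
    by (metis null_uminus)
qed

lemma null_scale:
  fixes c :: "'t::tract"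
  assumes "c \<noteq> 0" "A \<in> null"
  shows "image_mset ((*) c) A \<in> null"
  using null_times[of "{#c#}" A] assms by (simp add: formal_times_def)

lemma tract_inverse_right: "a \<noteq> 0 \<Longrightarrow> a * inverse a = (1::'t::tract)"
  by (metis mult.commute tract_inverse)

lemma tract_mult_eq_0_iff [simp]: "a * b = 0 \<longleftrightarrow> a = 0 \<or> b = (0::'t::tract)"
  by (metis mult.assoc mult_zero_left mult_zero_right mult.left_neutral tract_inverse)

lemma tract_inverse_nonzero: "a \<noteq> 0 \<Longrightarrow> inverse a \<noteq> (0::'t::tract)"
  using tract_inverse[of a] by auto

lemma tract_mult_left_cancel: "c \<noteq> 0 \<Longrightarrow> c * a = c * b \<longleftrightarrow> a = (b::'t::tract)"
  by (metis mult.assoc mult.left_neutral tract_inverse)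

lemma formal_scale: "c \<noteq> 0 \<Longrightarrow> formal (c * a) = image_mset ((*) c) (formal (a::'t::tract))"
  by (simp add: formal_def)

text \<open>Scaling the null sum of \<open>1\<close> and \<open>- 1\<close> by \<open>a\<close>
  gives a null sum of \<open>a\<close> and \<open>a * - 1\<close>, and additive inverses are
  unique.\<close>

lemma tract_uminus_eq: "- a = - 1 * (a::'t::tract)"
proof (cases "a = 0")
  case False
  have "formal 1 + formal (- 1 :: 't) \<in> null"
    by (simp add: null_uminus)
  from null_scale[OF False this] have "formal a + formal (a * - 1) \<in> null"
    using False by (simp flip: formal_scale)
  thus ?thesis
    by (simp add: null_uminus mult.commute)
qed simp

lemma tract_minus_minus [simp]: "- (- a) = (a::'t::tract)"
  using null_uminus[of a "- a"] null_uminus[of "- a" a] by (simp add: add.commute)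

lemma tract_mult_minus_left [simp]: "- a * b = - (a * b :: 't::tract)"
  by (metis mult.assoc tract_uminus_eq)

lemma tract_mult_minus_right [simp]: "a * - b = - (a * b :: 't::tract)"
  by (metis mult.commute tract_mult_minus_left)

lemma tract_minus_eq_iff [simp]: "- a = - b \<longleftrightarrow> a = (b::'t::tract)"
  by (metis tract_minus_minus)

lemma tract_minus_eq_0_iff [simp]: "- a = 0 \<longleftrightarrow> a = (0::'t::tract)"
  by (metis tract_minus_minus tract_uminus_zero)

lemma null_scale_iff:
  fixes c :: "'t::tract"
  assumes "c \<noteq> 0"
  shows "image_mset ((*) c) A \<in> null \<longleftrightarrow> A \<in> null"
proof
  assume "image_mset ((*) c) A \<in> null"
  from null_scale[OF tract_inverse_nonzero[OF assms] this]
  show "A \<in> null"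
    using assms by (simp add: image_mset.compositionality o_def tract_inverse flip: mult.assoc)
qed (rule null_scale[OF assms])

section \<open>Three-term relations\<close>

text \<open>Common shape \<open>x - y + z\<close> of (GP3) and of the covector condition in rank
  two, with the sign of the middle term built in.\<close>

definition three_term :: "'t::tract \<Rightarrow> 't \<Rightarrow> 't \<Rightarrow> bool" where
  "three_term x y z \<longleftrightarrow> formal x + formal (- y) + formal z \<in> null"

lemma three_term_scale:
  fixes c :: "'t::tract"
  assumes "c \<noteq> 0"
  shows "three_term (c * x) (c * y) (c * z) \<longleftrightarrow> three_term x y z"
proof -
  have "formal (c * x) + formal (- (c * y)) + formal (c * z) =
      image_mset ((*) c) (formal x + formal (- y) + formal z)"
    using formal_scale[OF assms, of x] formal_scale[OF assms, of "- y"] formal_scale[OF assms, of z]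
    by simp
  thus ?thesis
    by (simp only: three_term_def null_scale_iff[OF assms])
qed

lemma formal_zero [simp]: "formal (0::'t::tract) = {#}"
  by (simp add: formal_def)

text \<open>By uniqueness of additive inverses, a relation with a vanishing term is an equality. The
  exchange and quotient arguments extract their ratios in this way.\<close>

lemma three_term_zero [simp]:
  "three_term 0 0 (0::'t::tract)"
  "three_term 0 x y \<longleftrightarrow> x = (y::'t)"
  "three_term x y 0 \<longleftrightarrow> x = (y::'t)"
  "three_term x 0 y \<longleftrightarrow> x = - (y::'t)"
proof -
  show "three_term 0 0 (0::'t::tract)"
    by (simp add: three_term_def null_empty)
  show "three_term 0 x y \<longleftrightarrow> x = (y::'t)"
    using null_uminus[of y "- x"] by (auto simp: three_term_def add.commute)
  show "three_term x y 0 \<longleftrightarrow> x = (y::'t)"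
    using null_uminus[of x "- y"] by (auto simp: three_term_def)
  show "three_term x 0 y \<longleftrightarrow> x = - (y::'t)"
    using null_uminus[of y x] by (auto simp: three_term_def add.commute)
qed

section \<open>Independent sets and flats of a matroid\<close>

locale basis_matroid =
  fixes E :: "'e set" and Bs :: "'e set set"
  assumes M: "matroid E Bs"
begin

abbreviation rk :: nat where "rk \<equiv> mrank Bs E"
abbreviation ind :: "'e set \<Rightarrow> bool" where "ind \<equiv> indep Bs"

text \<open>Closure phrased through independence instead of rank. It is the closure for independent
  \<open>I\<close>, and all of \<open>E\<close> for dependent \<open>I\<close>.\<close>

definition span :: "'e set \<Rightarrow> 'e set" where
  "span I = {e \<in> E. e \<in> I \<or> \<not> ind (insert e I)}"

lemma finite_E: "finite E" and Bs_ne: "Bs \<noteq> {}" and Bs_subset: "B \<in> Bs \<Longrightarrow> B \<subseteq> E"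
  and Bs_exchange: "B \<in> Bs \<Longrightarrow> B' \<in> Bs \<Longrightarrow> x \<in> B - B' \<Longrightarrow> \<exists>y\<in>B' - B. insert y (B - {x}) \<in> Bs"
  using M unfolding matroid_def by blast+

lemma finite_Bs: "B \<in> Bs \<Longrightarrow> finite B"
  using Bs_subset finite_E finite_subset by blast

lemma ind_subset_E: "ind I \<Longrightarrow> I \<subseteq> E"
  unfolding indep_def using Bs_subset by blast

lemma finite_ind: "ind I \<Longrightarrow> finite I"
  using ind_subset_E finite_E finite_subset by blast

lemma ind_mono: "ind J \<Longrightarrow> I \<subseteq> J \<Longrightarrow> ind I"
  unfolding indep_def by blast

lemma ind_empty: "ind {}"
  using Bs_ne unfolding indep_def by blast

section \<open>Equicardinality of bases and augmentation\<close>

text \<open>Each exchange replaces an element of \<open>B - B'\<close> by one of \<open>B'\<close>,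
  keeping \<open>card B\<close> and shrinking the difference until \<open>B\<close> lies inside
  \<open>B'\<close>.\<close>

lemma card_Bs_le:
  assumes "B \<in> Bs" "B' \<in> Bs"
  shows "card B \<le> card B'"
  using assms(1)
proof (induction "card (B - B')" arbitrary: B rule: less_induct)
  case less
  show ?case
  proof (cases "B - B' = {}")
    case True
    thus ?thesis using finite_Bs[OF assms(2)] by (simp add: card_mono)
  next
    case False
    then obtain x where x: "x \<in> B - B'" by blast
    from Bs_exchange[OF less.prems assms(2) x]
    obtain y where y: "y \<in> B' - B" "insert y (B - {x}) \<in> Bs" by blast
    have "insert y (B - {x}) - B' = (B - B') - {x}"
      using y by blast
    hence "card (insert y (B - {x}) - B') < card (B - B')"
      using x finite_Bs[OF less.prems] by (metis DiffI DiffD1 DiffD2 card_Diff1_less finite_Diff)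
    from less.hyps[OF this y(2)] have "card (insert y (B - {x})) \<le> card B'" .
    moreover have "card (insert y (B - {x})) = card B"
      using x y finite_Bs[OF less.prems]
      by (metis Diff_iff card.insert card_Suc_Diff1 finite_Diff)
    ultimately show ?thesis by simp
  qed
qed

lemma card_Bs_eq: "B \<in> Bs \<Longrightarrow> B' \<in> Bs \<Longrightarrow> card B = card B'"
  by (simp add: card_Bs_le le_antisym)

text \<open>Let \<open>B1\<close> extend \<open>I\<close>, and let \<open>B2\<close> extend
  \<open>J\<close> with as few elements outside \<open>J\<close> and \<open>B1\<close> as possible.
  If no element of \<open>J\<close> augments \<open>I\<close>, exchanges in both directions give
  \<open>B2 - B1 = J - I\<close> and put \<open>B1 - B2\<close> inside \<open>I - J\<close>. Since
  bases are equicardinal, \<open>card J\<close> cannot exceed \<open>card I\<close>.\<close>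

lemma ind_augment:
  assumes I: "ind I" and J: "ind J" and less: "card I < card J"
  shows "\<exists>x\<in>J - I. ind (insert x I)"
proof (rule ccontr)
  assume no: "\<not> ?thesis"
  obtain B1 where B1: "B1 \<in> Bs" "I \<subseteq> B1" using I unfolding indep_def by blast
  obtain B0 where "B0 \<in> Bs \<and> J \<subseteq> B0" using J unfolding indep_def by blast
  from ex_has_least_nat[of "\<lambda>B. B \<in> Bs \<and> J \<subseteq> B", OF this, of "\<lambda>B. card (B - (J \<union> B1))"]
  obtain B2 where B2: "B2 \<in> Bs \<and> J \<subseteq> B2"
    and min: "\<And>B. B \<in> Bs \<and> J \<subseteq> B \<Longrightarrow> card (B2 - (J \<union> B1)) \<le> card (B - (J \<union> B1))"
    by (elim exE conjE) (rule that, auto)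
  \<comment> \<open>An element of \<open>J\<close> in \<open>B1\<close> but not in \<open>I\<close>
    would augment \<open>I\<close> inside \<open>B1\<close>.\<close>
  have JB1: "J \<inter> B1 \<subseteq> I"
    using no B1 unfolding indep_def by blast
  have "B2 - (J \<union> B1) = {}"
  proof (rule ccontr)
    assume "B2 - (J \<union> B1) \<noteq> {}"
    then obtain x where x: "x \<in> B2 - (J \<union> B1)" by blast
    then obtain y where y: "y \<in> B1 - B2" "insert y (B2 - {x}) \<in> Bs"
      using Bs_exchange[of B2 B1 x] B2 B1 by blast
    have "card (B2 - (J \<union> B1)) \<le> card (insert y (B2 - {x}) - (J \<union> B1))"
      using y x B2 by (intro min) blast
    also have "insert y (B2 - {x}) - (J \<union> B1) = (B2 - (J \<union> B1)) - {x}"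
      using y by blast
    also have "card \<dots> < card (B2 - (J \<union> B1))"
      using x B2 finite_Bs by (intro card_Diff1_less) auto
    finally show False by simp
  qed
  hence B21: "B2 - B1 \<subseteq> J - I" using B1 by blast
  have "B1 - (I \<union> B2) = {}"
  proof (rule ccontr)
    assume "B1 - (I \<union> B2) \<noteq> {}"
    then obtain x where x: "x \<in> B1 - (I \<union> B2)" by blast
    then obtain y where y: "y \<in> B2 - B1" "insert y (B1 - {x}) \<in> Bs"
      using Bs_exchange[of B1 B2 x] B2 B1 by blast
    \<comment> \<open>As \<open>x\<close> is outside \<open>I\<close>, the exchanged basis still
      contains \<open>I\<close>, so \<open>y\<close>, which lies in \<open>J\<close>, augments
      \<open>I\<close>.\<close>
    moreover have "insert y I \<subseteq> insert y (B1 - {x})" using x B1 by blast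
    ultimately have "ind (insert y I)" unfolding indep_def by blast
    thus False using no y B21 by blast
  qed
  hence B12: "B1 - B2 \<subseteq> I - J" using B2 by blast
  have fin: "finite B1" "finite B2" "finite I" "finite J"
    using finite_Bs B1 B2 finite_ind I J by auto
  have "J - I \<subseteq> B2 - B1" using B2 JB1 by blast
  hence "card (J - I) \<le> card (B2 - B1)" using fin by (simp add: card_mono)
  also have "\<dots> = card (B1 - B2)"
    using card_Bs_eq[of B1 B2] B1 B2 fin by (simp add: card_le_sym_Diff le_antisym)
  also have "\<dots> \<le> card (I - J)" using B12 fin by (simp add: card_mono)
  finally have "card J \<le> card I"
    using fin card_Int_Diff[of J I] card_Int_Diff[of I J] by (simp add: Int_commute)
  thus False using less by simp
qed

section \<open>Rank, closure and flats through independent sets\<close>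

text \<open>Augmentation makes an inclusion-maximal independent subset of \<open>A\<close> one of
  maximum size.\<close>

lemma mrank_eq:
  assumes "basis_of Bs A I"
  shows "mrank Bs A = card I"
proof -
  let ?S = "{J. J \<subseteq> A \<and> ind J}"
  have I: "I \<subseteq> A" "ind I" and max: "\<And>J. I \<subseteq> J \<Longrightarrow> J \<subseteq> A \<Longrightarrow> ind J \<Longrightarrow> J = I"
    using assms unfolding basis_of_def by blast+
  have "?S \<subseteq> Pow E" using ind_subset_E by blast
  hence fin: "finite ?S" using finite_E finite_subset by blast
  have "card J \<le> card I" if J: "J \<subseteq> A" "ind J" for J
  proof (rule ccontr)
    assume "\<not> card J \<le> card I"
    then obtain x where "x \<in> J - I" "ind (insert x I)"
      using ind_augment[OF I(2) J(2)] by auto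
    thus False using max[of "insert x I"] I J by blast
  qed
  thus ?thesis
    unfolding mrank_def using fin I by (intro Max_eqI) auto
qed

lemma ind_extend:
  assumes "ind I" "I \<subseteq> A"
  shows "\<exists>J. I \<subseteq> J \<and> basis_of Bs A J"
proof -
  let ?P = "\<lambda>J. I \<subseteq> J \<and> J \<subseteq> A \<and> ind J"
  have "\<forall>J. ?P J \<longrightarrow> card J < Suc (card E)"
    using ind_subset_E finite_E by (simp add: card_mono less_Suc_eq_le)
  from ex_has_greatest_nat[of ?P I card, OF _ this] assms
  obtain J where J: "?P J" and max: "\<And>K. ?P K \<Longrightarrow> card K \<le> card J"
    by auto
  have "K = J" if "J \<subseteq> K" "K \<subseteq> A" "ind K" for K
    using max[of K] that J finite_ind[of K] by (metis card_subset_eq card_mono le_antisym subset_trans)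
  thus ?thesis using J unfolding basis_of_def by blast
qed

lemma Bs_antichain: "B \<in> Bs \<Longrightarrow> B' \<in> Bs \<Longrightarrow> B \<subseteq> B' \<Longrightarrow> B = B'"
  using card_subset_eq[OF finite_Bs] card_Bs_eq by blast

lemma basis_of_E: "B \<in> Bs \<Longrightarrow> basis_of Bs E B"
  unfolding basis_of_def indep_def using Bs_subset Bs_antichain by blast

lemma card_Bs: "B \<in> Bs \<Longrightarrow> card B = rk"
  using mrank_eq[OF basis_of_E] by simp

lemma card_ind_le: "ind I \<Longrightarrow> card I \<le> rk"
  unfolding indep_def by (auto simp: card_mono finite_Bs simp flip: card_Bs)

lemma ind_card_rk: "ind I \<Longrightarrow> card I = rk \<Longrightarrow> I \<in> Bs"
  unfolding indep_def by (metis card_Bs finite_Bs card_subset_eq)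

lemma Bs_ind: "B \<in> Bs \<Longrightarrow> ind B"
  unfolding indep_def by blast

lemma Bs_iff: "B \<in> Bs \<longleftrightarrow> ind B \<and> card B = rk"
  using Bs_ind card_Bs ind_card_rk by blast

lemma ind_augment_rk:
  assumes "ind I" "card I < rk"
  shows "\<exists>x\<in>E - I. ind (insert x I)"
proof -
  obtain B where B: "B \<in> Bs" using Bs_ne by blast
  with ind_augment[OF assms(1) Bs_ind[OF B]] assms(2) card_Bs[OF B] show ?thesis
    using Bs_subset[OF B] by auto
qed

text \<open>If \<open>e\<close> is in \<open>I\<close> or depends on it, \<open>I\<close> stays a
  basis of \<open>insert e A\<close>; otherwise a basis containing \<open>insert e I\<close> raises
  the rank.\<close>

lemma mclosure_eq_span:
  assumes "basis_of Bs A I"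
  shows "mclosure E Bs A = span I"
proof -
  have I: "I \<subseteq> A" "ind I" and max: "\<And>J. I \<subseteq> J \<Longrightarrow> J \<subseteq> A \<Longrightarrow> ind J \<Longrightarrow> J = I"
    using assms unfolding basis_of_def by blast+
  have "mrank Bs (insert e A) = mrank Bs A \<longleftrightarrow> e \<in> I \<or> \<not> ind (insert e I)" if "e \<in> E" for e
  proof (cases "e \<in> I \<or> \<not> ind (insert e I)")
    case True
    have "J = I" if J: "I \<subseteq> J" "J \<subseteq> insert e A" "ind J" for J
    proof (cases "e \<in> J")
      case True2: True
      hence "e \<in> I" using True J ind_mono[of J "insert e I"] by blast
      thus ?thesis using max J I by blast
    next
      case False
      thus ?thesis using max J by blast
    qed
    hence "basis_of Bs (insert e A) I"
      unfolding basis_of_def using I by blast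
    thus ?thesis using True mrank_eq assms by simp
  next
    case False
    then obtain J where J: "insert e I \<subseteq> J" "basis_of Bs (insert e A) J"
      using ind_extend[of "insert e I" "insert e A"] I by blast
    hence "finite J" unfolding basis_of_def using finite_ind by blast
    hence "card (insert e I) \<le> card J" using J card_mono by blast
    moreover have "card (insert e I) = Suc (card I)"
      using False finite_ind[OF I(2)] by simp
    ultimately show ?thesis using False mrank_eq[OF J(2)] mrank_eq[OF assms] by simp
  qed
  thus ?thesis unfolding mclosure_def span_def by blast
qed

lemma basis_of_self: "ind I \<Longrightarrow> basis_of Bs I I"
  unfolding basis_of_def by blast

lemma basis_of_span:
  assumes "ind I"
  shows "basis_of Bs (span I) I"
  unfolding basis_of_def
proof (intro conjI allI impI)
  show "I \<subseteq> span I" using ind_subset_E[OF assms] unfolding span_def by blast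
  fix J assume J: "I \<subseteq> J \<and> J \<subseteq> span I \<and> ind J"
  have "x \<in> I" if "x \<in> J" for x
    using J that ind_mono[of J "insert x I"] unfolding span_def by auto
  thus "J = I" using J by blast
qed (rule assms)

lemma span_flat: "ind I \<Longrightarrow> span I \<in> flats E Bs"
  using mclosure_eq_span[OF basis_of_span] unfolding flats_def span_def by blast

lemma corank_span: "ind I \<Longrightarrow> corank E Bs (span I) = rk - card I"
  using mrank_eq[OF basis_of_span] unfolding corank_def by simp

lemma flat_eq_span: "F \<in> flats E Bs \<Longrightarrow> basis_of Bs F I \<Longrightarrow> F = span I"
  using mclosure_eq_span unfolding flats_def by blast

lemma flat_basis:
  assumes "F \<in> flats E Bs"
  obtains I where "basis_of Bs F I"
  using ind_extend[OF ind_empty, of F] by blast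

lemma basis_of_indep: "basis_of Bs F I \<Longrightarrow> ind I"
  unfolding basis_of_def by blast

lemma flat_corank_iff:
  assumes "0 < k"
  shows "F \<in> flats E Bs \<and> corank E Bs F = k \<longleftrightarrow> (\<exists>I. ind I \<and> card I + k = rk \<and> F = span I)"
proof
  assume F: "F \<in> flats E Bs \<and> corank E Bs F = k"
  then obtain I where I: "basis_of Bs F I" using flat_basis by blast
  hence "ind I" "F = span I" using F flat_eq_span basis_of_indep by blast+
  thus "\<exists>I. ind I \<and> card I + k = rk \<and> F = span I"
    using F corank_span[of I] assms by (intro exI[of _ I]) auto
qed (use span_flat corank_span in auto)

lemma hyperplane_iff:
  "H \<in> hyperplanes E Bs \<longleftrightarrow> (\<exists>I. ind I \<and> card I + 1 = rk \<and> H = span I)"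
  using flat_corank_iff[of 1 H] unfolding hyperplanes_def by simp

lemma span_mono_insert: "x \<in> span I \<Longrightarrow> x \<in> span (insert e I)"
  unfolding span_def using ind_mono[of "insert x (insert e I)" "insert x I"] by blast

text \<open>Every independent subset of \<open>span I\<close> has at most \<open>card I\<close>
  elements, so \<open>J\<close> is another basis of the flat \<open>span I\<close>.\<close>

lemma span_eqI:
  assumes "ind I" "ind J" "card I = card J" "J \<subseteq> span I"
  shows "span J = span I"
proof -
  have "basis_of Bs (span I) J"
    unfolding basis_of_def
  proof (intro conjI allI impI)
    fix K assume K: "J \<subseteq> K \<and> K \<subseteq> span I \<and> ind K"
    hence "card K \<le> card I"
    proof (rule_tac ccontr)
      assume "\<not> card K \<le> card I"
      then obtain x where "x \<in> K - I" "ind (insert x I)" using ind_augment[OF assms(1), of K] K by auto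
      thus False using K unfolding span_def by blast
    qed
    thus "K = J" using K assms(3) finite_ind[of K] by (metis card_seteq)
  qed (use assms in auto)
  from flat_eq_span[OF span_flat[OF assms(1)] this] show ?thesis by simp
qed

end

section \<open>Alternating functions\<close>

text \<open>Sign rule for adjacent entries only, which passes easily to lists with a fixed prefix.
  Where \<open>- 1 = 1\<close> it does not force vanishing on repeated entries; that is part of the
  support condition of \<open>contr_gp\<close>.\<close>

definition swap_neg :: "'e set \<Rightarrow> nat \<Rightarrow> ('e list \<Rightarrow> 't::tract) \<Rightarrow> bool" where
  "swap_neg E s f \<longleftrightarrow>
     (\<forall>us a b vs. us @ a # b # vs \<in> tuples E s \<longrightarrow> f (us @ a # b # vs) = - f (us @ b # a # vs))"

lemma swap_negD:
  "swap_neg E s f \<Longrightarrow> us @ a # b # vs \<in> tuples E s \<Longrightarrow> f (us @ a # b # vs) = - f (us @ b # a # vs)"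
  unfolding swap_neg_def by blast

lemma permute_list_transpose:
  "permute_list (transpose (length us) (Suc (length us + length zs))) (us @ a # zs @ b # vs) =
     us @ b # zs @ a # vs"
  (is "permute_list (transpose ?i ?j) ?xs = _")
proof (rule nth_equalityI)
  fix k assume "k < length (permute_list (transpose ?i ?j) ?xs)"
  hence k: "permute_list (transpose ?i ?j) ?xs ! k = ?xs ! transpose ?i ?j k"
    by (intro permute_list_nth permutes_swap_id) auto
  consider "k < ?i" | "k = ?i" | l where "k = Suc (?i + l)" "l < length zs" | "k = ?j"
    | l where "k = Suc (?j + l)"
  proof -
    assume *: "k < ?i \<Longrightarrow> thesis" "k = ?i \<Longrightarrow> thesis"
      "\<And>l. k = Suc (?i + l) \<Longrightarrow> l < length zs \<Longrightarrow> thesis" "k = ?j \<Longrightarrow> thesis"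
      "\<And>l. k = Suc (?j + l) \<Longrightarrow> thesis"
    show thesis
      using *(1,2,4) *(3)[of "k - Suc ?i"] *(5)[of "k - Suc ?j"] by linarith
  qed
  thus "permute_list (transpose ?i ?j) ?xs ! k = (us @ b # zs @ a # vs) ! k"
    unfolding k by cases (simp_all add: nth_append transpose_def)
qed simp

lemma permute_list_append:
  assumes "p permutes {..<length ys}"
  shows "permute_list p (ys @ zs) = permute_list p ys @ zs"
proof (rule nth_equalityI)
  have p: "p permutes {..<length (ys @ zs)}" by (rule permutes_subset[OF assms]) auto
  fix k assume "k < length (permute_list p (ys @ zs))"
  hence k: "permute_list p (ys @ zs) ! k = (ys @ zs) ! p k" using permute_list_nth[OF p] by simp
  show "permute_list p (ys @ zs) ! k = (permute_list p ys @ zs) ! k"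
  proof (cases "k < length ys")
    case True
    hence "p k < length ys" using permutes_in_image[OF assms, of k] by simp
    thus ?thesis using k True permute_list_nth[OF assms True] by (simp add: nth_append)
  next
    case False
    hence "p k = k" using permutes_not_in[OF assms] by simp
    thus ?thesis using k False by (simp add: nth_append)
  qed
qed simp

lemma permute_list_tuples:
  "p permutes {..<s} \<Longrightarrow> xs \<in> tuples E s \<Longrightarrow> permute_list p xs \<in> tuples E s"
  unfolding tuples_def by auto

lemma tract_sign_transpose: "i \<noteq> j \<Longrightarrow> tract_sign (transpose i j) = (- 1 :: 't::tract)"
  by (simp add: tract_sign_def sign_swap_id)

lemma tract_sign_compose:
  assumes "permutation p" "permutation q"
  shows "tract_sign (p \<circ> q) = (tract_sign p * tract_sign q :: 't::tract)"
  using sign_compose[OF assms] by (auto simp: tract_sign_def sign_def)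

lemma tract_sign_nonzero: "tract_sign p \<noteq> (0::'t::tract)"
  by (simp add: tract_sign_def)

lemma alternating_swap_neg:
  assumes "alternating E s f"
  shows "swap_neg E s f"
  unfolding swap_neg_def
proof (intro allI impI)
  fix us a b vs assume t: "us @ a # b # vs \<in> tuples E s"
  let ?p = "transpose (length us) (Suc (length us))"
  have "?p permutes {..<s}"
    using t by (intro permutes_swap_id) (auto simp: tuples_def)
  hence "f (permute_list ?p (us @ a # b # vs)) = tract_sign ?p * f (us @ a # b # vs)"
    using assms t unfolding alternating_def by blast
  thus "f (us @ a # b # vs) = - f (us @ b # a # vs)"
    using permute_list_transpose[of us "[]" a b vs] by (simp add: tract_sign_transpose)
qed

text \<open>\<open>a\<close> passes \<open>z\<close>, changes places with \<open>b\<close> by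
  induction, and \<open>b\<close> passes \<open>z\<close> back: three sign changes.\<close>

lemma swap_neg_far:
  assumes "swap_neg E s f"
  shows "us @ a # zs @ b # vs \<in> tuples E s \<Longrightarrow>
    f (us @ a # zs @ b # vs) = - f (us @ b # zs @ a # vs)"
proof (induction zs arbitrary: us)
  case Nil
  thus ?case using swap_negD[OF assms, of us a b vs] by simp
next
  case (Cons z zs)
  have "f (us @ a # (z # zs) @ b # vs) = - f (us @ z # a # zs @ b # vs)"
    using swap_negD[OF assms, of us a z "zs @ b # vs"] Cons.prems by simp
  also have "f (us @ z # a # zs @ b # vs) = - f (us @ z # b # zs @ a # vs)"
    using Cons.IH[of "us @ [z]"] Cons.prems by (simp add: tuples_def)
  also have "f (us @ z # b # zs @ a # vs) = - f (us @ b # z # zs @ a # vs)"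
    using swap_negD[OF assms, of us z b "zs @ a # vs"] Cons.prems by (simp add: tuples_def)
  finally show ?case by simp
qed

lemma swap_neg_transpose:
  assumes "swap_neg E s f" "xs \<in> tuples E s" "i < j" "j < s"
  shows "f (permute_list (transpose i j) xs) = - f xs"
proof -
  have len: "length xs = s" using assms(2) by (simp add: tuples_def)
  define us where "us = take i xs"
  define zs where "zs = take (j - Suc i) (drop (Suc i) xs)"
  define vs where "vs = drop (Suc j) xs"
  have "xs = us @ xs ! i # drop (Suc i) xs"
    unfolding us_def using assms len by (simp add: id_take_nth_drop)
  moreover have "drop (Suc i) xs = zs @ xs ! j # vs"
    using id_take_nth_drop[of "j - Suc i" "drop (Suc i) xs"] assms len
    by (simp add: zs_def vs_def)
  ultimately have xs: "xs = us @ xs ! i # zs @ xs ! j # vs" by simp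
  have "length us = i" "Suc (length us + length zs) = j"
    using assms len by (auto simp: us_def zs_def)
  hence "permute_list (transpose i j) xs = us @ xs ! j # zs @ xs ! i # vs"
    using permute_list_transpose[of us zs "xs ! i" "xs ! j" vs] xs by simp
  thus ?thesis using swap_neg_far[OF assms(1), of us "xs ! i" zs "xs ! j" vs] xs assms(2)
    by (metis tract_minus_minus)
qed

text \<open>Permutations are products of transpositions, each of which changes the sign by
  \<open>swap_neg_transpose\<close>.\<close>

lemma swap_neg_permute:
  assumes "swap_neg E s f" "p permutes {..<s}"
  shows "xs \<in> tuples E s \<Longrightarrow> f (permute_list p xs) = tract_sign p * f xs"
  using assms(2) finite_lessThan
proof (induction p arbitrary: xs rule: permutes_induct)
  case id
  show ?case by (simp add: tract_sign_def)
next
  case (swap i j p)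
  have ij: "transpose i j permutes {..<s}" using swap by (simp add: permutes_swap_id)
  have "f (permute_list (transpose i j) xs) = - f xs"
    using swap swap_neg_transpose[OF assms(1) swap.prems, of i j]
      swap_neg_transpose[OF assms(1) swap.prems, of j i]
    by (cases "i < j") (auto simp: transpose_commute)
  moreover have "permute_list (transpose i j \<circ> p) xs = permute_list p (permute_list (transpose i j) xs)"
    using swap by (intro permute_list_compose) (simp add: tuples_def)
  moreover have "tract_sign (transpose i j \<circ> p) = (- tract_sign p :: 'b)"
    using swap by (subst tract_sign_compose)
      (auto simp: tract_sign_transpose permutation_swap_id intro: permutes_imp_permutation)
  ultimately show ?case
    using swap.IH[OF permute_list_tuples[OF ij swap.prems]] by (metis tract_mult_minus_left tract_mult_minus_right)
qed

section \<open>Proportional functions and classes modulo units\<close>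

text \<open>Equality of classes tested on the tuples alone, so that functions under construction may
  take any values elsewhere.\<close>

definition proportional :: "'e set \<Rightarrow> nat \<Rightarrow> ('e list \<Rightarrow> 't::tract) \<Rightarrow> ('e list \<Rightarrow> 't) \<Rightarrow> bool" where
  "proportional E s f g \<longleftrightarrow> (\<exists>a. a \<noteq> 0 \<and> (\<forall>xs\<in>tuples E s. f xs = a * g xs))"

lemma proportional_refl: "proportional E s f f"
  unfolding proportional_def by (rule exI[of _ 1]) simp

lemma proportional_sym:
  assumes "proportional E s f g"
  shows "proportional E s g f"
proof -
  obtain a where a: "a \<noteq> 0" "\<And>xs. xs \<in> tuples E s \<Longrightarrow> f xs = a * g xs"
    using assms unfolding proportional_def by blast
  thus ?thesis
    unfolding proportional_def
    by (intro exI[of _ "inverse a"]) (simp add: tract_inverse tract_inverse_nonzero flip: mult.assoc)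
qed

lemma proportional_trans [trans]:
  assumes "proportional E s f g" "proportional E s g h"
  shows "proportional E s f h"
proof -
  obtain a where a: "a \<noteq> 0" "\<And>xs. xs \<in> tuples E s \<Longrightarrow> f xs = a * g xs"
    using assms(1) unfolding proportional_def by blast
  obtain b where b: "b \<noteq> 0" "\<And>xs. xs \<in> tuples E s \<Longrightarrow> g xs = b * h xs"
    using assms(2) unfolding proportional_def by blast
  show ?thesis
    unfolding proportional_def using a b by (intro exI[of _ "a * b"]) (simp add: mult.assoc)
qed

lemma proportional_gp_class:
  assumes "proportional E s f g"
  shows "gp_class E s f = gp_class E s g"
proof -
  have *: "gp_class E s f \<subseteq> gp_class E s g" if fg: "proportional E s f g" for f g :: "'a list \<Rightarrow> 'b"
  proof
    fix h assume "h \<in> gp_class E s f"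
    then obtain b where b: "b \<noteq> 0" "h = gp_scale E s b f" unfolding gp_class_def by blast
    obtain a where a: "a \<noteq> 0" "\<And>xs. xs \<in> tuples E s \<Longrightarrow> f xs = a * g xs"
      using fg unfolding proportional_def by blast
    have "h = gp_scale E s (b * a) g"
      unfolding b gp_scale_def using a by (intro restrict_ext) (simp add: mult.assoc)
    thus "h \<in> gp_class E s g" unfolding gp_class_def using a b by auto
  qed
  show ?thesis using *[OF assms] *[OF proportional_sym[OF assms]] by blast
qed

lemma gp_class_proportional:
  assumes "gp_class E s f = gp_class E s g"
  shows "proportional E s f g"
proof -
  \<comment> \<open>The scalar \<open>1\<close> places the restriction of \<open>f\<close> in its
    own class.\<close>
  have "gp_scale E s 1 f \<in> gp_class E s g"
    unfolding assms[symmetric] unfolding gp_class_def using zero_neq_one by force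
  then obtain a where a: "a \<noteq> 0" "gp_scale E s 1 f = gp_scale E s a g"
    unfolding gp_class_def by blast
  have "f xs = a * g xs" if "xs \<in> tuples E s" for xs
    using fun_cong[OF a(2), of xs] that by (simp add: gp_scale_def)
  thus ?thesis unfolding proportional_def using a by blast
qed

lemma tuples_Cons [simp]: "x # xs \<in> tuples E (Suc s) \<longleftrightarrow> x \<in> E \<and> xs \<in> tuples E s"
  by (auto simp: tuples_def)

section \<open>Cocycles on a graph whose non-edges are parallel pairs\<close>

text \<open>Non-adjacency acts as parallelism by \<open>par\<close>, and \<open>nbr\<close> joins
  every vertex to a base vertex \<open>o'\<close> by a path of length two. \<open>c x\<close> is the
  product of \<open>g\<close> along such a path; the triangle rule \<open>tri\<close> makes it
  independent of the middle vertex.\<close>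

lemma cocycle_trivial:
  fixes g :: "'a \<Rightarrow> 'a \<Rightarrow> 't::tract"
  assumes adj: "\<And>x y. adj x y \<Longrightarrow> adj y x \<and> x \<in> P \<and> y \<in> P"
    and nz: "\<And>x y. adj x y \<Longrightarrow> g x y \<noteq> 0"
    and inv: "\<And>x y. adj x y \<Longrightarrow> g x y * g y x = 1"
    and tri: "\<And>x y z. adj x y \<Longrightarrow> adj y z \<Longrightarrow> adj x z \<Longrightarrow> g x y * g y z = g x z"
    and par: "\<And>x y v. x \<in> P \<Longrightarrow> y \<in> P \<Longrightarrow> \<not> adj x y \<Longrightarrow> adj v x \<Longrightarrow> adj v y"
    and nbr: "\<And>x y. x \<in> P \<Longrightarrow> y \<in> P \<Longrightarrow> \<exists>w. adj w x \<and> adj w y"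
  shows "\<exists>c. (\<forall>x\<in>P. c x \<noteq> 0) \<and> (\<forall>x y. adj x y \<longrightarrow> c x = g x y * c y)"
proof (cases "P = {}")
  case True
  thus ?thesis using adj by blast
next
  case False
  then obtain o' where o': "o' \<in> P" by blast
  define path where "path x w = g x w * g w o'" for x w
  define c where "c x = path x (SOME w. adj w x \<and> adj w o')" for x
  have path_direct: "path x w = g x o'" if "adj w x" "adj w o'" "adj x o'" for x w
    unfolding path_def using that adj tri by blast
  have path_step: "path x w = path x v" if "adj w x" "adj w o'" "adj v x" "adj v o'" "adj w v" for x w v
  proof -
    have "path x w = g x w * (g w v * g v o')"
      unfolding path_def using that tri by simp
    also have "\<dots> = (g x w * g w v) * g v o'" by (simp add: mult.assoc)
    also have "g x w * g w v = g x v" using that adj tri by blast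
    finally show ?thesis unfolding path_def .
  qed
  have path_eq: "path x w = path x w'" if w: "adj w x" "adj w o'" "adj w' x" "adj w' o'" for x w w'
  proof -
    consider "adj x o'" | "adj w w'" | "\<not> adj x o'" "\<not> adj w w'" by blast
    thus ?thesis
    proof cases
      case 1
      thus ?thesis using path_direct w by simp
    next
      case 2
      thus ?thesis using path_step w by blast
    next
      case 3
      \<comment> \<open>Here \<open>x\<close> is parallel to \<open>o'\<close> and \<open>w\<close>
        to \<open>w'\<close>, so a common neighbour \<open>v\<close> of \<open>x\<close> and
        \<open>w\<close> is adjacent to all four, and both paths can be compared with the one
        through \<open>v\<close>.\<close>
      obtain v where v: "adj v x" "adj v w" using nbr[of x w] w adj by blast
      have "adj v o'" using par[of x o' v] 3 v w adj o' by blast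
      moreover have "adj v w'" using par[of w w' v] 3 v w adj by blast
      ultimately have "path x w = path x v" "path x w' = path x v"
        using path_step v w adj by blast+
      thus ?thesis by simp
    qed
  qed
  have c_path: "c x = path x w" if "adj w x" "adj w o'" for x w
  proof -
    have "adj (SOME w. adj w x \<and> adj w o') x \<and> adj (SOME w. adj w x \<and> adj w o') o'"
      by (rule someI[of "\<lambda>w. adj w x \<and> adj w o'" w]) (use that in blast)
    thus ?thesis unfolding c_def using path_eq that by blast
  qed
  have c_direct: "c x = g x o'" if x: "adj x o'" for x
  proof -
    have "x \<in> P" using adj x by blast
    then obtain w where "adj w x" "adj w o'" using nbr[of x o'] o' by blast
    thus ?thesis using c_path path_direct x by simp
  qed
  have "c x = g x y * c y" if xy: "adj x y" for x y
  proof -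
    have P: "x \<in> P" "y \<in> P" "adj y x" using xy adj by blast+
    consider "adj x o'" "adj y o'" | "\<not> adj x o'" | "\<not> adj y o'" by blast
    thus ?thesis
    proof cases
      case 1
      thus ?thesis using c_direct tri[of x y o'] xy by simp
    next
      case 2
      \<comment> \<open>Since \<open>x\<close> is parallel to \<open>o'\<close>, its neighbour
        \<open>y\<close> is itself a middle vertex for \<open>x\<close>.\<close>
      have "adj y o'" using par[of x o' y] 2 P o' by blast
      thus ?thesis using c_path[of y x] c_direct[of y] P by (simp add: path_def)
    next
      case 3
      have "adj x o'" using par[of y o' x] 3 P o' xy by blast
      hence "c y = g y x * c x" using c_path[of x y] c_direct[of x] xy by (simp add: path_def)
      thus ?thesis using inv[OF xy] by (metis mult.assoc mult.left_neutral)
    qed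
  qed
  moreover have "c x \<noteq> 0" if x: "x \<in> P" for x
  proof -
    obtain w where "adj w x" "adj w o'" using nbr[of x o'] o' x by blast
    thus ?thesis using c_path[of w x] nz[of x w] nz[of w o'] adj by (auto simp: path_def)
  qed
  ultimately show ?thesis by blast
qed

section \<open>Grassmann-Pluecker functions of contractions\<close>

context basis_matroid
begin

text \<open>Grassmann-Pluecker functions of the contraction by \<open>I\<close>, kept on the whole
  ground set with the elements of \<open>I\<close> as loops. The first clause fixes the bases and
  includes vanishing on repeated entries; values off the tuples are left free.\<close>

definition contr_gp :: "'e set \<Rightarrow> ('e list \<Rightarrow> 't::tract) \<Rightarrow> bool" where
  "contr_gp I f \<longleftrightarrow>
     (\<forall>xs\<in>tuples E (rk - card I). f xs \<noteq> 0 \<longleftrightarrow> distinct xs \<and> set xs \<inter> I = {} \<and> I \<union> set xs \<in> Bs) \<and>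
     swap_neg E (rk - card I) f \<and>
     (\<forall>es a b c d. length es + 2 = rk - card I \<and> set es \<subseteq> E \<and> {a, b, c, d} \<subseteq> E \<longrightarrow>
        three_term (f (es @ [a, b]) * f (es @ [c, d])) (f (es @ [a, c]) * f (es @ [b, d]))
          (f (es @ [a, d]) * f (es @ [b, c])))"

lemma contr_gp_nonzero:
  "contr_gp I f \<Longrightarrow> xs \<in> tuples E (rk - card I) \<Longrightarrow>
     f xs \<noteq> 0 \<longleftrightarrow> distinct xs \<and> set xs \<inter> I = {} \<and> I \<union> set xs \<in> Bs"
  unfolding contr_gp_def by blast

lemma contr_gp_swap: "contr_gp I f \<Longrightarrow> swap_neg E (rk - card I) f"
  unfolding contr_gp_def by blast

lemma contr_gp_three_term:
  assumes "contr_gp I f" "length es + 2 = rk - card I" "set es \<subseteq> E" "a \<in> E" "b \<in> E" "c \<in> E" "d \<in> E"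
  shows "three_term (f (es @ [a, b]) * f (es @ [c, d])) (f (es @ [a, c]) * f (es @ [b, d]))
          (f (es @ [a, d]) * f (es @ [b, c]))"
  using assms unfolding contr_gp_def by blast

lemma corank_insert:
  assumes "ind (insert e I)" "e \<notin> I"
  shows "rk - card I = Suc (rk - card (insert e I))"
proof -
  have "finite I" using finite_ind[OF assms(1)] by simp
  thus ?thesis using card_ind_le[OF assms(1)] assms(2) by simp
qed

text \<open>A fixed first entry \<open>e\<close> stays in front of every swap and every three-term
  relation, so the contraction by \<open>e\<close> inherits all clauses.\<close>

lemma contr_gp_Cons:
  assumes f: "contr_gp I f" and e: "e \<notin> I" "ind (insert e I)"
  shows "contr_gp (insert e I) (\<lambda>xs. f (e # xs))"
proof -
  let ?s = "rk - card (insert e I)"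
  have s: "rk - card I = Suc ?s" by (rule corank_insert[OF e(2,1)])
  have eE: "e \<in> E" using ind_subset_E[OF e(2)] by blast
  show ?thesis
    unfolding contr_gp_def
  proof (intro conjI ballI allI impI)
    fix xs assume "xs \<in> tuples E ?s"
    hence "e # xs \<in> tuples E (rk - card I)" using s eE by simp
    from contr_gp_nonzero[OF f this]
    show "f (e # xs) \<noteq> 0 \<longleftrightarrow> distinct xs \<and> set xs \<inter> insert e I = {} \<and> insert e I \<union> set xs \<in> Bs"
      using e(1) by auto
  next
    show "swap_neg E ?s (\<lambda>xs. f (e # xs))"
      unfolding swap_neg_def
      using swap_negD[OF contr_gp_swap[OF f], of "e # _"] s eE by simp
  next
    fix es a b c d
    assume *: "length es + 2 = ?s \<and> set es \<subseteq> E \<and> {a, b, c, d} \<subseteq> E"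
    show "three_term (f (e # es @ [a, b]) * f (e # es @ [c, d])) (f (e # es @ [a, c]) * f (e # es @ [b, d]))
          (f (e # es @ [a, d]) * f (e # es @ [b, c]))"
      using contr_gp_three_term[OF f, of "e # es" a b c d] * eE s by simp
  qed
qed

lemma contr_gp_append:
  assumes "contr_gp I f" "distinct xs" "set xs \<inter> I = {}" "ind (I \<union> set xs)"
  shows "contr_gp (I \<union> set xs) (\<lambda>ys. f (xs @ ys))"
  using assms
proof (induction xs arbitrary: I f)
  case (Cons x xs)
  have "contr_gp (insert x I) (\<lambda>xs. f (x # xs))"
    using Cons.prems by (intro contr_gp_Cons) (auto intro: ind_mono)
  from Cons.IH[OF this] Cons.prems show ?case by simp
qed simp

lemma contr_gp_bases:
  assumes f: "contr_gp I f" and I: "ind I"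
  shows "gp_bases E (rk - card I) (restrict f (tuples E (rk - card I))) = {B - I |B. B \<in> Bs \<and> I \<subseteq> B}"
    (is "gp_bases E ?s ?f = ?R")
proof (intro subset_antisym subsetI)
  fix X assume "X \<in> gp_bases E ?s ?f"
  then obtain es where es: "X = set es" "es \<in> tuples E ?s" "f es \<noteq> 0"
    unfolding gp_bases_def by auto
  hence "set es \<inter> I = {}" "I \<union> set es \<in> Bs" using contr_gp_nonzero[OF f] by auto
  thus "X \<in> ?R" using es by (intro CollectI exI[of _ "I \<union> set es"]) auto
next
  fix X assume "X \<in> ?R"
  then obtain B where B: "X = B - I" "B \<in> Bs" "I \<subseteq> B" by blast
  obtain es where es: "set es = B - I" "distinct es"
    using finite_distinct_list[of "B - I"] finite_Bs[OF B(2)] by blast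
  have "length es = card (B - I)" using es distinct_card by metis
  hence "length es = ?s" using B card_Bs finite_ind[OF I] by (simp add: card_Diff_subset)
  hence t: "es \<in> tuples E ?s" using es Bs_subset[OF B(2)] by (auto simp: tuples_def)
  have "I \<union> set es = B" using es B by blast
  hence "f es \<noteq> 0" using contr_gp_nonzero[OF f t] es B by auto
  thus "X \<in> gp_bases E ?s ?f" unfolding gp_bases_def using t es B by auto
qed

text \<open>Bases that contain \<open>I\<close> differ only outside \<open>I\<close>, so an exchange
  between them keeps \<open>I\<close>.\<close>

lemma matroid_contraction:
  assumes I: "ind I"
  shows "matroid E {B - I |B. B \<in> Bs \<and> I \<subseteq> B}"
  unfolding matroid_def
proof (intro conjI ballI)
  show "{B - I |B. B \<in> Bs \<and> I \<subseteq> B} \<noteq> {}" using I unfolding indep_def by blast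
  fix X X' x
  assume "X \<in> {B - I |B. B \<in> Bs \<and> I \<subseteq> B}" "X' \<in> {B - I |B. B \<in> Bs \<and> I \<subseteq> B}" and x: "x \<in> X - X'"
  then obtain B B' where B: "X = B - I" "B \<in> Bs" "I \<subseteq> B" and B': "X' = B' - I" "B' \<in> Bs" "I \<subseteq> B'"
    by blast
  obtain y where y: "y \<in> B' - B" "insert y (B - {x}) \<in> Bs"
    using Bs_exchange[OF B(2) B'(2), of x] x B B' by blast
  have "insert y (X - {x}) = insert y (B - {x}) - I" using y B by blast
  moreover have "I \<subseteq> insert y (B - {x})" using x B by blast
  ultimately show "\<exists>y\<in>X' - X. insert y (X - {x}) \<in> {B - I |B. B \<in> Bs \<and> I \<subseteq> B}"
    using y B B' by (intro bexI[of _ y]) auto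
qed (use finite_E Bs_subset in auto)

lemma contr_gp_gp_function:
  assumes f: "contr_gp I f" and I: "ind I"
  shows "gp_function E (rk - card I) (restrict f (tuples E (rk - card I)))"
    (is "gp_function E ?s ?f")
  unfolding gp_function_def
proof (intro conjI allI impI)
  show "matroid E (gp_bases E ?s ?f)"
    using contr_gp_bases[OF assms] matroid_contraction[OF I] by simp
  show "alternating E ?s ?f"
    unfolding alternating_def
  proof (intro conjI ballI allI impI)
    fix es assume "es \<in> tuples E ?s" "\<not> distinct es"
    thus "?f es = 0" using contr_gp_nonzero[OF f, of es] by auto
  next
    fix es p assume "es \<in> tuples E ?s" "p permutes {..<?s}"
    thus "?f (permute_list p es) = tract_sign p * ?f es"
      using swap_neg_permute[OF contr_gp_swap[OF f]] permute_list_tuples by fastforce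
  qed
  fix es a b c d
  assume *: "length es + 2 = ?s \<and> set es \<subseteq> E \<and> {a, b, c, d} \<subseteq> E"
  hence "es @ [u, v] \<in> tuples E ?s" if "u \<in> E" "v \<in> E" for u v
    using that by (auto simp: tuples_def)
  thus "formal (?f (es @ [a, b]) * ?f (es @ [c, d])) +
      formal (- (?f (es @ [a, c]) * ?f (es @ [b, d]))) + formal (?f (es @ [a, d]) * ?f (es @ [b, c])) \<in> null"
    using contr_gp_three_term[OF f, of es a b c d] * by (simp add: three_term_def)
qed simp

text \<open>Membership in \<open>gp_bases\<close> gives a nonzero value on some ordering of a basis;
  alternation carries it to every ordering.\<close>

lemma gp_function_contr_gp:
  assumes f: "gp_function E rk f" and bases: "gp_bases E rk f = Bs"
  shows "contr_gp {} f"
proof -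
  have alt: "alternating E rk f" using f unfolding gp_function_def by blast
  have supp: "f xs \<noteq> 0 \<longleftrightarrow> distinct xs \<and> set xs \<in> Bs" if xs: "xs \<in> tuples E rk" for xs
  proof
    assume "f xs \<noteq> 0"
    hence "distinct xs" using alt xs unfolding alternating_def by blast
    moreover from this have "set xs \<in> gp_bases E rk f"
      using \<open>f xs \<noteq> 0\<close> xs unfolding gp_bases_def by blast
    ultimately show "distinct xs \<and> set xs \<in> Bs"
      using bases by simp
  next
    assume *: "distinct xs \<and> set xs \<in> Bs"
    hence "set xs \<in> gp_bases E rk f" using bases by simp
    then obtain es where es: "set xs = set es" "es \<in> tuples E rk" "distinct es" "f es \<noteq> 0"
      unfolding gp_bases_def by auto
    hence "mset xs = mset es" using * set_eq_iff_mset_eq_distinct by blast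
    then obtain p where p: "p permutes {..<length es}" "permute_list p es = xs"
      by (rule mset_eq_permutation)
    moreover have "length es = rk" using es by (simp add: tuples_def)
    ultimately have "f xs = tract_sign p * f es"
      using alt es unfolding alternating_def by metis
    thus "f xs \<noteq> 0" using es tract_sign_nonzero[of p] by simp
  qed
  show ?thesis
    unfolding contr_gp_def using supp alternating_swap_neg[OF alt] f
    unfolding gp_function_def three_term_def by simp
qed

section \<open>Points of a contraction and the graph of non-parallel pairs\<close>

text \<open>Nonloops of the contraction by \<open>I\<close>; parallel elements are kept as different
  points.\<close>

definition points :: "'e set \<Rightarrow> 'e set" where
  "points I = {x. x \<notin> I \<and> ind (insert x I)}"

text \<open>Edges join points that are independent in the contraction, so distinct non-adjacent
  points are exactly the parallel pairs.\<close>

definition adj :: "'e set \<Rightarrow> 'e \<Rightarrow> 'e \<Rightarrow> bool" where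
  "adj I x y \<longleftrightarrow> x \<noteq> y \<and> x \<notin> I \<and> y \<notin> I \<and> ind (insert x (insert y I))"

lemma adj_points: "adj I x y \<Longrightarrow> adj I y x \<and> x \<in> points I \<and> y \<in> points I"
  unfolding adj_def points_def by (auto simp: insert_commute intro: ind_mono)

lemma points_in_E: "x \<in> points I \<Longrightarrow> x \<in> E"
  unfolding points_def using ind_subset_E by blast

lemma card_insert_points: "x \<in> points I \<Longrightarrow> card (insert x I) = Suc (card I)"
  unfolding points_def using finite_ind[of "insert x I"] by auto

lemma card_insert_adj: "adj I x y \<Longrightarrow> card (insert x (insert y I)) = Suc (Suc (card I))"
  unfolding adj_def using finite_ind[of "insert x (insert y I)"] by auto

text \<open>In the contraction the independent pair \<open>v\<close>, \<open>x\<close> augments the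
  single point \<open>y\<close>; as \<open>x\<close> is parallel to \<open>y\<close>, the augmenting
  element is \<open>v\<close>.\<close>

lemma adj_parallel:
  assumes "x \<in> points I" "y \<in> points I" "\<not> adj I x y" "adj I v x"
  shows "adj I v y"
proof -
  have "card (insert y I) < card (insert v (insert x I))"
    using card_insert_points[OF assms(2)] card_insert_adj[OF assms(4)] by simp
  then obtain z where z: "z \<in> insert v (insert x I) - insert y I" "ind (insert z (insert y I))"
    using ind_augment[of "insert y I" "insert v (insert x I)"] assms unfolding adj_def points_def by blast
  hence "z \<noteq> x" using assms unfolding adj_def points_def by blast
  thus ?thesis using z assms unfolding adj_def points_def by blast
qed

lemma adj_exists:
  assumes "x \<in> points I" "card I + 2 \<le> rk"
  shows "\<exists>w. adj I w x"
  using ind_augment_rk[of "insert x I"] card_insert_points[OF assms(1)] assms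
  unfolding adj_def points_def by auto

text \<open>In rank at least three a third point exists off the line of two adjacent points; for
  parallel points any neighbour of one serves.\<close>

lemma common_neighbour:
  assumes "x \<in> points I" "y \<in> points I" "card I + 3 \<le> rk"
  shows "\<exists>w. adj I w x \<and> adj I w y"
proof (cases "adj I x y")
  case True
  then obtain w where w: "w \<in> E - insert x (insert y I)" "ind (insert w (insert x (insert y I)))"
    using ind_augment_rk[of "insert x (insert y I)"] card_insert_adj[OF True] assms(3)
    unfolding adj_def by auto
  have "ind (insert w (insert x I))" "ind (insert w (insert y I))"
    using w(2) by (auto intro: ind_mono)
  thus ?thesis using w True unfolding adj_def by blast
next
  case False
  obtain w where "adj I w x" using adj_exists[of x I] assms by auto
  thus ?thesis using adj_parallel[OF assms(1,2) False] by blast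
qed

text \<open>Take \<open>w\<close> off the line through \<open>x\<close> and \<open>y\<close>.
  Augmenting the pair \<open>y\<close>, \<open>z\<close> or \<open>x\<close>, \<open>z\<close> from
  the independent triple \<open>w\<close>, \<open>x\<close>, \<open>y\<close> must add
  \<open>w\<close>, because the remaining point is on the line.\<close>

lemma outside_line:
  assumes xy: "adj I x y" and yz: "adj I y z" and xz: "adj I x z"
    and line: "\<not> ind (insert x (insert y (insert z I)))" and rk: "card I + 3 \<le> rk"
  shows "\<exists>w. w \<notin> I \<and> w \<noteq> x \<and> w \<noteq> y \<and> w \<noteq> z \<and> ind (insert w (insert x (insert y I))) \<and>
    ind (insert w (insert y (insert z I))) \<and> ind (insert w (insert x (insert z I)))"
proof -
  obtain w where w: "w \<in> E - insert x (insert y I)" "ind (insert w (insert x (insert y I)))"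
    using ind_augment_rk[of "insert x (insert y I)"] card_insert_adj[OF xy] rk xy
    unfolding adj_def by auto
  have wz: "w \<noteq> z" using w line by (metis insert_commute)
  have "finite (insert x (insert y I))" using xy finite_ind[of "insert x (insert y I)"] unfolding adj_def by simp
  hence card: "card (insert w (insert x (insert y I))) = Suc (Suc (Suc (card I)))"
    using w card_insert_adj[OF xy] by simp
  obtain u where "u \<in> insert w (insert x (insert y I)) - insert y (insert z I)"
      "ind (insert u (insert y (insert z I)))"
    using ind_augment[of "insert y (insert z I)" "insert w (insert x (insert y I))"] card
      card_insert_adj[OF yz] w yz unfolding adj_def by auto
  hence 1: "ind (insert w (insert y (insert z I)))" using line by blast
  obtain u where "u \<in> insert w (insert x (insert y I)) - insert x (insert z I)"
      "ind (insert u (insert x (insert z I)))"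
    using ind_augment[of "insert x (insert z I)" "insert w (insert x (insert y I))"] card
      card_insert_adj[OF xz] w xz unfolding adj_def by auto
  hence "ind (insert w (insert x (insert z I)))" using line by (auto simp: insert_commute)
  thus ?thesis using 1 w wz by blast
qed

lemma complete_to_basis:
  assumes "ind I"
  obtains xs where "xs \<in> tuples E (rk - card I)" "distinct xs" "set xs \<inter> I = {}" "I \<union> set xs \<in> Bs"
proof -
  obtain B where B: "B \<in> Bs" "I \<subseteq> B" using assms unfolding indep_def by blast
  obtain xs where xs: "set xs = B - I" "distinct xs"
    using finite_distinct_list[of "B - I"] finite_Bs[OF B(1)] by blast
  have "length xs = card (B - I)" using xs distinct_card by metis
  hence "length xs = rk - card I" using B card_Bs finite_ind[OF assms] by (simp add: card_Diff_subset)
  moreover have "I \<union> set xs = B" using xs B by blast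
  ultimately show ?thesis using that[of xs] xs B Bs_subset[OF B(1)] by (auto simp: tuples_def)
qed

section \<open>Gluing functions on one-element contractions\<close>

lemma contr_gp_zero:
  assumes "contr_gp I f" "x # xs \<in> tuples E (rk - card I)" "x \<notin> points I"
  shows "f (x # xs) = 0"
  using contr_gp_nonzero[OF assms(1,2)] assms(3) unfolding points_def
  by (auto intro: ind_mono Bs_ind)

text \<open>Both scalars are read off one basis containing \<open>x\<close> and \<open>y\<close>, listed in the two orders.\<close>

lemma contr_gp_proportional_glue:
  assumes I: "ind I" and rk2: "card I + 2 \<le> rk" and f: "contr_gp I f" and g: "contr_gp I g"
    and loc: "\<And>x. x \<in> points I \<Longrightarrow>
      proportional E (rk - Suc (card I)) (\<lambda>xs. f (x # xs)) (\<lambda>xs. g (x # xs))"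
  shows "proportional E (rk - card I) f g"
proof -
  let ?s = "rk - Suc (card I)"
  have s: "rk - card I = Suc ?s" using rk2 by simp
  have "\<forall>x\<in>points I. \<exists>a. a \<noteq> 0 \<and> (\<forall>xs\<in>tuples E ?s. f (x # xs) = a * g (x # xs))"
    using loc unfolding proportional_def by blast
  then obtain c where c: "\<And>x. x \<in> points I \<Longrightarrow> c x \<noteq> 0"
    and fg: "\<And>x xs. x \<in> points I \<Longrightarrow> xs \<in> tuples E ?s \<Longrightarrow> f (x # xs) = c x * g (x # xs)"
    unfolding bchoice_iff by blast
  have c_adj: "c x = c y" if xy: "adj I x y" for x y
  proof -
    have P: "x \<in> points I" "y \<in> points I" using adj_points[OF xy] by auto
    have "ind (insert x (insert y I))" using xy unfolding adj_def by blast
    then obtain xs where xs: "xs \<in> tuples E (rk - card (insert x (insert y I)))" "distinct xs"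
      "set xs \<inter> insert x (insert y I) = {}" "insert x (insert y I) \<union> set xs \<in> Bs"
      by (rule complete_to_basis)
    have s': "?s = Suc (rk - card (insert x (insert y I)))"
      using card_insert_adj[OF xy] rk2 by simp
    have t: "y # xs \<in> tuples E ?s" "x # xs \<in> tuples E ?s" "x \<in> E" "y \<in> E"
      unfolding s' using xs P points_in_E by auto
    have "g (x # y # xs) \<noteq> 0"
      using contr_gp_nonzero[OF g, of "x # y # xs"] xs t s xy unfolding adj_def by auto
    moreover have "f (x # y # xs) = - f (y # x # xs)" "g (x # y # xs) = - g (y # x # xs)"
      using swap_negD[OF contr_gp_swap[OF f], of "[]" x y xs]
        swap_negD[OF contr_gp_swap[OF g], of "[]" x y xs] t s by auto
    ultimately show ?thesis
      using fg[OF P(1) t(1)] fg[OF P(2) t(2)]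
      by (metis mult.commute tract_mult_left_cancel tract_mult_minus_right)
  qed
  \<comment> \<open>Parallel points are compared through a common neighbour.\<close>
  have c_const: "c x = c y" if P: "x \<in> points I" "y \<in> points I" for x y
  proof (cases "adj I x y")
    case False
    obtain w where "adj I w x" using adj_exists[OF P(1) rk2] by blast
    thus ?thesis using c_adj[of w x] c_adj[of w y] adj_parallel[OF P False] by simp
  qed (rule c_adj)
  obtain x0 where x0: "x0 \<in> points I"
    using ind_augment_rk[OF I] rk2 unfolding points_def by auto
  have "f xs = c x0 * g xs" if xs: "xs \<in> tuples E (rk - card I)" for xs
  proof -
    obtain x ys where ys: "xs = x # ys" "x \<in> E" "ys \<in> tuples E ?s"
      using xs s by (cases xs) (auto simp: tuples_def)
    show ?thesis
    proof (cases "x \<in> points I")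
      case True
      thus ?thesis using fg[OF True ys(3)] c_const[OF True x0] ys by simp
    next
      case False
      thus ?thesis using contr_gp_zero[OF f _ False] contr_gp_zero[OF g _ False] xs ys by simp
    qed
  qed
  thus ?thesis unfolding proportional_def using c[OF x0] by blast
qed

text \<open>On a basis through \<open>x\<close>, \<open>y\<close>, \<open>z\<close>, alternation of
  the functions for \<open>x\<close>, \<open>y\<close> and \<open>z\<close> gives three sign
  relations between values of the functions for pairs. In their product these nonzero values cancel,
  and the three signs leave one minus.\<close>

lemma contr_gp_triangle:
  assumes f: "\<And>u. u \<in> points I \<Longrightarrow> contr_gp (insert u I) (\<Phi> (insert u I))"
    and \<alpha>: "\<And>u v. adj I u v \<Longrightarrow> \<alpha> u v \<noteq> 0"
    and fac: "\<And>u v xs. adj I u v \<Longrightarrow> xs \<in> tuples E (rk - card I - 2) \<Longrightarrow>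
      \<Phi> (insert u I) (v # xs) = \<alpha> u v * \<Phi> (insert u (insert v I)) xs"
    and adj: "adj I x y" "adj I y z" "adj I x z" and ind: "ind (insert x (insert y (insert z I)))"
  shows "\<alpha> x y * \<alpha> y z * \<alpha> z x = - (\<alpha> y x * \<alpha> z y * \<alpha> x z :: 't::tract)"
proof -
  have ne: "x \<noteq> y" "y \<noteq> z" "x \<noteq> z" "x \<notin> I" "y \<notin> I" "z \<notin> I"
    using adj unfolding adj_def by auto
  have "finite I" using finite_ind[OF ind] by simp
  hence card: "card (insert x (insert y (insert z I))) = card I + 3" using ne by simp
  hence rk3: "card I + 3 \<le> rk" using card_ind_le[OF ind] by simp
  from ind obtain xs where xs: "xs \<in> tuples E (rk - card (insert x (insert y (insert z I))))"
    "distinct xs" "set xs \<inter> insert x (insert y (insert z I)) = {}"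
    "insert x (insert y (insert z I)) \<union> set xs \<in> Bs"
    by (rule complete_to_basis)
  define s where "s = rk - card I - 3"
  have s: "xs \<in> tuples E s" "rk - card I - 2 = Suc s" using xs rk3 by (auto simp: card s_def)
  \<comment> \<open>Value of the function for the pair \<open>u\<close>, \<open>v\<close> on a basis
    completed by \<open>w\<close> and the fixed list \<open>xs\<close>. Its symmetry in
    \<open>u\<close> and \<open>v\<close> allows the later cancellation.\<close>
  define N where "N u v w = \<Phi> (insert u (insert v I)) (w # xs)" for u v w
  have N_comm: "N u v w = N v u w" for u v w
    unfolding N_def by (simp add: insert_commute)
  have *: "\<alpha> u v * N u v w = - (\<alpha> u w * N u w v) \<and> N u v w \<noteq> 0"
    if uvw: "{u, v, w} = {x, y, z}" and a: "adj I u v" "adj I u w" and vw: "v \<noteq> w" for u v w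
  proof -
    have P: "u \<in> points I" "v \<in> E" "w \<in> E" using a adj_points points_in_E by blast+
    have c: "rk - card (insert u I) = Suc (Suc s)"
      using card_insert_points[OF P(1)] rk3 by (simp add: s_def)
    have t: "v # w # xs \<in> tuples E (rk - card (insert u I))" using c s P by simp
    have set: "insert u I \<union> set (v # w # xs) = insert x (insert y (insert z I)) \<union> set xs"
      using uvw by auto
    have "v \<notin> set xs" "w \<notin> set xs" "u \<notin> set xs" using uvw xs(3) by auto
    hence "\<Phi> (insert u I) (v # w # xs) \<noteq> 0"
      unfolding contr_gp_nonzero[OF f[OF P(1)] t] set using xs a vw unfolding adj_def by auto
    moreover have "\<Phi> (insert u I) (v # w # xs) = \<alpha> u v * N u v w"
      unfolding N_def using fac[OF a(1), of "w # xs"] s P by simp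
    moreover have "\<Phi> (insert u I) (w # v # xs) = \<alpha> u w * N u w v"
      unfolding N_def using fac[OF a(2), of "v # xs"] s P by simp
    moreover have "\<Phi> (insert u I) (v # w # xs) = - \<Phi> (insert u I) (w # v # xs)"
      using swap_negD[OF contr_gp_swap[OF f[OF P(1)]], of "[]" v w xs] t by simp
    ultimately show ?thesis by auto
  qed
  have adj': "adj I y x" "adj I z y" "adj I z x" using adj adj_points by blast+
  have 1: "\<alpha> x y * N x y z = - (\<alpha> x z * N x z y)" "N x y z \<noteq> 0"
    using *[of x y z] adj adj' ne by auto
  have 2: "\<alpha> y z * N y z x = - (\<alpha> y x * N x y z)" "N y z x \<noteq> 0"
    using *[of y z x] adj adj' ne N_comm[of y x] by (auto simp: insert_commute)
  have 3: "\<alpha> z x * N x z y = - (\<alpha> z y * N y z x)" "N x z y \<noteq> 0"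
    using *[of z x y] adj adj' ne N_comm[of z x] N_comm[of z y] by (auto simp: insert_commute)
  have "(N x y z * N y z x * N x z y) * (\<alpha> x y * \<alpha> y z * \<alpha> z x) =
      (\<alpha> x y * N x y z) * (\<alpha> y z * N y z x) * (\<alpha> z x * N x z y)"
    by (simp only: ac_simps)
  also have "\<dots> = - ((\<alpha> x z * N x z y) * (\<alpha> y x * N x y z) * (\<alpha> z y * N y z x))"
    unfolding 1(1) 2(1) 3(1) by simp
  also have "\<dots> = (N x y z * N y z x * N x z y) * - (\<alpha> y x * \<alpha> z y * \<alpha> x z)"
    unfolding tract_mult_minus_right tract_minus_eq_iff by (simp only: ac_simps)
  finally show ?thesis
    by (rule tract_mult_left_cancel[THEN iffD1, rotated]) (use 1 2 3 in simp)
qed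

text \<open>The candidate is \<open>h (x # ys) = c x * \<Phi> (insert x I) ys\<close>. Only a swap
  of the first two entries ties different points together; it requires
  \<open>c x * \<alpha> x y = - (c y * \<alpha> y x)\<close>, a coboundary equation for
  \<open>g\<close>. All other swaps and the three-term relations act behind the first entry.\<close>

lemma contr_gp_extend:
  fixes \<Phi> :: "'e set \<Rightarrow> 'e list \<Rightarrow> 't::tract"
  assumes I: "ind I" and rk3: "card I + 3 \<le> rk"
    and f: "\<And>u. u \<in> points I \<Longrightarrow> contr_gp (insert u I) (\<Phi> (insert u I))"
    and loc: "\<And>u v. adj I u v \<Longrightarrow>
      proportional E (rk - card I - 2) (\<lambda>xs. \<Phi> (insert u I) (v # xs)) (\<Phi> (insert v (insert u I)))"
  shows "\<exists>h. contr_gp I h \<and>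
    (\<forall>u\<in>points I. proportional E (rk - card I - 1) (\<lambda>xs. h (u # xs)) (\<Phi> (insert u I)))"
proof -
  define \<alpha> where "\<alpha> u v = (SOME a. a \<noteq> 0 \<and> (\<forall>xs\<in>tuples E (rk - card I - 2).
    \<Phi> (insert u I) (v # xs) = a * \<Phi> (insert v (insert u I)) xs))" for u v
  have \<alpha>': "\<alpha> u v \<noteq> 0 \<and> (\<forall>xs\<in>tuples E (rk - card I - 2).
    \<Phi> (insert u I) (v # xs) = \<alpha> u v * \<Phi> (insert v (insert u I)) xs)" if "adj I u v" for u v
    unfolding \<alpha>_def by (rule someI_ex) (use loc[OF that] in \<open>simp add: proportional_def\<close>)
  have \<alpha>: "\<alpha> u v \<noteq> 0" if "adj I u v" for u v using \<alpha>'[OF that] by blast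
  have fac: "\<Phi> (insert u I) (v # xs) = \<alpha> u v * \<Phi> (insert u (insert v I)) xs"
    if "adj I u v" "xs \<in> tuples E (rk - card I - 2)" for u v xs
    using \<alpha>'[OF that(1)] that(2) by (simp add: insert_commute)
  \<comment> \<open>The ratio that \<open>c u\<close> and \<open>c v\<close> must have for the first
    two entries to alternate.\<close>
  define g where "g u v = - (\<alpha> v u * inverse (\<alpha> u v))" for u v
  have adj_sym: "adj I v u" if "adj I u v" for u v using adj_points[OF that] by blast
  have g_inv: "g u v * g v u = 1" if "adj I u v" for u v
  proof -
    have "g u v * g v u = (\<alpha> u v * inverse (\<alpha> u v)) * (\<alpha> v u * inverse (\<alpha> v u))"
      unfolding g_def tract_mult_minus_left tract_mult_minus_right tract_minus_minus
      by (simp only: ac_simps)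
    thus ?thesis
      using tract_inverse_right[OF \<alpha>[OF that]] tract_inverse_right[OF \<alpha>[OF adj_sym[OF that]]] by simp
  qed
  have g_tri_ind: "g x y * g y z = g x z"
    if a: "adj I x y" "adj I y z" "adj I x z" and ind: "ind (insert x (insert y (insert z I)))" for x y z
  proof -
    let ?p = "\<alpha> x y" and ?q = "\<alpha> y z" and ?r = "\<alpha> x z"
    have nz: "?p \<noteq> 0" "?q \<noteq> 0" "?r \<noteq> 0" using \<alpha> a by auto
    \<comment> \<open>Multiplying by the three denominators turns the cocycle rule into the identity
      of \<open>contr_gp_triangle\<close>.\<close>
    have "(?p * ?q * ?r) * (g x y * g y z) =
        (?p * inverse ?p) * (?q * inverse ?q) * (\<alpha> y x * \<alpha> z y * \<alpha> x z)"
      unfolding g_def tract_mult_minus_left tract_mult_minus_right tract_minus_minus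
      by (simp only: ac_simps)
    also have "\<dots> = - (\<alpha> x y * \<alpha> y z * \<alpha> z x)"
      using contr_gp_triangle[of I \<Phi> \<alpha>, OF f \<alpha> fac a ind] nz by (simp add: tract_inverse_right)
    also have "\<dots> = - ((?r * inverse ?r) * (?p * ?q * \<alpha> z x))"
      using nz by (simp add: tract_inverse_right)
    also have "\<dots> = (?p * ?q * ?r) * g x z"
      unfolding g_def tract_mult_minus_right tract_minus_eq_iff by (simp only: ac_simps)
    finally show ?thesis
      by (rule tract_mult_left_cancel[THEN iffD1, rotated]) (use nz in simp)
  qed
  have g_tri: "g x y * g y z = g x z" if a: "adj I x y" "adj I y z" "adj I x z" for x y z
  proof (cases "ind (insert x (insert y (insert z I)))")
    case False
    \<comment> \<open>A collinear triple is coned over \<open>w\<close> off its line: the three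
      triangles with apex \<open>w\<close> are independent, and the detour from \<open>w\<close> to
      \<open>y\<close> and back cancels.\<close>
    from outside_line[OF a this rk3] obtain w where w: "w \<notin> I" "w \<noteq> x" "w \<noteq> y" "w \<noteq> z"
      and ind: "ind (insert w (insert x (insert y I)))" "ind (insert w (insert y (insert z I)))"
        "ind (insert w (insert x (insert z I)))"
      by blast
    have aw: "adj I x w" "adj I y w" "adj I z w"
      using a w ind_mono[OF ind(1), of "insert x (insert w I)"] ind_mono[OF ind(2), of "insert y (insert w I)"]
        ind_mono[OF ind(3), of "insert z (insert w I)"]
      unfolding adj_def by blast+
    have "g x y * g y z = (g x w * g w y) * (g y w * g w z)"
      using g_tri_ind[of x w y] g_tri_ind[of y w z] ind a aw adj_sym
      by (simp add: insert_commute)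
    also have "\<dots> = g x w * (g w y * g y w) * g w z" by (simp only: ac_simps)
    also have "\<dots> = g x w * g w z" using g_inv[of w y] aw adj_sym by simp
    also have "\<dots> = g x z" using g_tri_ind[of x w z] ind a aw adj_sym by (simp add: insert_commute)
    finally show ?thesis .
  qed (rule g_tri_ind[OF a])
  have "\<exists>c. (\<forall>x\<in>points I. c x \<noteq> 0) \<and> (\<forall>x y. adj I x y \<longrightarrow> c x = g x y * c y)"
  proof (rule cocycle_trivial)
    show "g x y \<noteq> 0" if "adj I x y" for x y
      unfolding g_def using \<alpha> adj_sym that by (simp add: tract_inverse_nonzero)
    show "adj I v y" if "x \<in> points I" "y \<in> points I" "\<not> adj I x y" "adj I v x" for x y v
      using adj_parallel that by blast
  qed (use adj_points g_inv g_tri common_neighbour rk3 in auto)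
  then obtain c where c: "\<And>x. x \<in> points I \<Longrightarrow> c x \<noteq> 0" and cg: "\<And>x y. adj I x y \<Longrightarrow> c x = g x y * c y"
    by blast
  have c\<alpha>: "c x * \<alpha> x y = - (c y * \<alpha> y x)" if a: "adj I x y" for x y
  proof -
    have "c x * \<alpha> x y = - ((\<alpha> x y * inverse (\<alpha> x y)) * (c y * \<alpha> y x))"
      unfolding cg[OF a] g_def tract_mult_minus_left tract_minus_eq_iff by (simp only: ac_simps)
    thus ?thesis using \<alpha>[OF a] by (simp add: tract_inverse_right)
  qed
  \<comment> \<open>A loop in first place gives zero, as the support demands. The empty list gets a
    default value only, since the corank is at least three.\<close>
  define h where "h xs = (case xs of [] \<Rightarrow> 0 | x # ys \<Rightarrow> if x \<in> points I then c x * \<Phi> (insert x I) ys else 0)" for xs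
  have h_Cons: "h (x # ys) = (if x \<in> points I then c x * \<Phi> (insert x I) ys else 0)" for x ys
    by (simp add: h_def)
  define s where "s = rk - card I - 1"
  have s: "rk - card I = Suc s" using rk3 by (simp add: s_def)
  have sP: "rk - card (insert x I) = s" if "x \<in> points I" for x
    using card_insert_points[OF that] by (simp add: s_def)
  have supp: "h xs \<noteq> 0 \<longleftrightarrow> distinct xs \<and> set xs \<inter> I = {} \<and> I \<union> set xs \<in> Bs"
    if xs: "xs \<in> tuples E (rk - card I)" for xs
  proof -
    obtain x ys where ys: "xs = x # ys" "x \<in> E" "ys \<in> tuples E s"
      using xs s by (cases xs) (auto simp: tuples_def)
    show ?thesis
    proof (cases "x \<in> points I")
      case True
      hence "h xs \<noteq> 0 \<longleftrightarrow> \<Phi> (insert x I) ys \<noteq> 0" using c ys h_Cons by simp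
      also have "\<dots> \<longleftrightarrow> distinct ys \<and> set ys \<inter> insert x I = {} \<and> insert x I \<union> set ys \<in> Bs"
        using contr_gp_nonzero[OF f[OF True], of ys] sP[OF True] ys by simp
      finally show ?thesis using ys True unfolding points_def by auto
    next
      case False
      hence "h xs = 0" using ys h_Cons by simp
      moreover have "\<not> (set xs \<inter> I = {} \<and> I \<union> set xs \<in> Bs)"
      proof
        assume *: "set xs \<inter> I = {} \<and> I \<union> set xs \<in> Bs"
        hence "ind (insert x I)" using ys by (intro ind_mono[OF Bs_ind[of "I \<union> set xs"]]) auto
        thus False using False * ys unfolding points_def by auto
      qed
      ultimately show ?thesis by blast
    qed
  qed
  have "contr_gp I h"
    unfolding contr_gp_def
  proof (intro conjI ballI allI impI)
    show "swap_neg E (rk - card I) h"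
      unfolding swap_neg_def
    proof (intro allI impI)
      fix us a b vs assume t: "us @ a # b # vs \<in> tuples E (rk - card I)"
      show "h (us @ a # b # vs) = - h (us @ b # a # vs)"
      proof (cases us)
        case Nil
        have t': "a # b # vs \<in> tuples E (rk - card I)" "b # a # vs \<in> tuples E (rk - card I)"
          using t Nil by (auto simp: tuples_def)
        show ?thesis
        proof (cases "adj I a b")
          case True
          have P: "a \<in> points I" "b \<in> points I" using adj_points[OF True] by auto
          have vs: "vs \<in> tuples E (rk - card I - 2)" using t' by (auto simp: tuples_def)
          have "h (a # b # vs) = (c a * \<alpha> a b) * \<Phi> (insert a (insert b I)) vs"
            using P fac[OF True vs] by (simp add: h_Cons mult.assoc)
          also have "\<dots> = - ((c b * \<alpha> b a) * \<Phi> (insert b (insert a I)) vs)"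
            using c\<alpha>[OF True] by (simp add: insert_commute)
          also have "\<dots> = - h (b # a # vs)"
            using P fac[OF adj_sym[OF True] vs] by (simp add: h_Cons mult.assoc)
          finally show ?thesis using Nil by simp
        next
          case False
          \<comment> \<open>Both orders of a non-adjacent pair are off the support, so both values
            vanish.\<close>
          have "h (u # v # vs) = 0" if uv: "{u, v} = {a, b}" "u # v # vs \<in> tuples E (rk - card I)" for u v
          proof (rule ccontr)
            assume "h (u # v # vs) \<noteq> 0"
            hence *: "distinct (u # v # vs)" "set (u # v # vs) \<inter> I = {}" "I \<union> set (u # v # vs) \<in> Bs"
              using supp[OF uv(2)] by blast+
            have "ind (insert a (insert b I))"
              using uv by (intro ind_mono[OF Bs_ind[OF *(3)]]) auto
            moreover have "a \<noteq> b" "a \<notin> I" "b \<notin> I" using uv(1) * by (auto simp: doubleton_eq_iff)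
            ultimately show False using False unfolding adj_def by blast
          qed
          from this[of a b] this[of b a] show ?thesis using t' Nil by (simp add: insert_commute)
        qed
      next
        case (Cons u us')
        have t': "us' @ a # b # vs \<in> tuples E s" using t Cons s by simp
        show ?thesis
        proof (cases "u \<in> points I")
          case True
          thus ?thesis
            using swap_negD[OF contr_gp_swap[OF f[OF True]], of us' a b vs] t' sP[OF True] Cons
            by (simp add: h_Cons)
        qed (simp add: Cons h_Cons)
      qed
    qed
  next
    fix es a b c' d
    assume *: "length es + 2 = rk - card I \<and> set es \<subseteq> E \<and> {a, b, c', d} \<subseteq> E"
    \<comment> \<open>Rank at least three leaves a nonempty common prefix, whose first entry
      \<open>u\<close> occurs in all six values.\<close>
    then obtain u es' where es: "es = u # es'" using rk3 by (cases es) auto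
    show "three_term (h (es @ [a, b]) * h (es @ [c', d])) (h (es @ [a, c']) * h (es @ [b, d]))
        (h (es @ [a, d]) * h (es @ [b, c']))"
    proof (cases "u \<in> points I")
      case True
      \<comment> \<open>Each product carries the common unit \<open>c u * c u\<close>, which scaling
        removes.\<close>
      have sq: "(c u * x) * (c u * y) = (c u * c u) * (x * y)" for x y by (simp only: ac_simps)
      have "length es' + 2 = rk - card (insert u I)" using * es sP[OF True] s by simp
      from contr_gp_three_term[OF f[OF True] this, of a b c' d] show ?thesis
        using * es True c[OF True] by (simp add: h_Cons sq three_term_scale)
    qed (simp add: es h_Cons)
  qed (rule supp)
  moreover have "proportional E (rk - card I - 1) (\<lambda>xs. h (u # xs)) (\<Phi> (insert u I))"
    if "u \<in> points I" for u
    unfolding proportional_def using that c by (auto simp: h_Cons)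
  ultimately show ?thesis by blast
qed

section \<open>Change of ordered basis, and uniqueness\<close>

text \<open>Reordering the prefix is a permutation that fixes all later positions, so the scalar is
  its sign.\<close>

lemma contr_gp_reorder:
  assumes f: "contr_gp {} f" and "distinct xs" "distinct ys" "set xs = set ys" "set ys \<subseteq> E"
    and len: "length ys + s = rk"
  shows "proportional E s (\<lambda>zs. f (xs @ zs)) (\<lambda>zs. f (ys @ zs))"
proof -
  have "mset xs = mset ys" using assms set_eq_iff_mset_eq_distinct by blast
  then obtain p where p: "p permutes {..<length ys}" "permute_list p ys = xs"
    by (rule mset_eq_permutation)
  have p': "p permutes {..<rk}" by (rule permutes_subset[OF p(1)]) (use len in auto)
  have "f (xs @ zs) = tract_sign p * f (ys @ zs)" if "zs \<in> tuples E s" for zs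
  proof -
    have "ys @ zs \<in> tuples E rk" using that assms by (auto simp: tuples_def)
    from swap_neg_permute[OF _ p' this, of f] contr_gp_swap[OF f]
    show ?thesis using permute_list_append[OF p(1), of zs] p by simp
  qed
  thus ?thesis unfolding proportional_def using tract_sign_nonzero[of p] by blast
qed

text \<open>As \<open>i\<close> and \<open>j\<close> are parallel over \<open>K\<close>, the value
  at \<open>K @ [i, j]\<close> vanishes, and the three-term relation says that the rows
  \<open>f (K @ [i, _])\<close> and \<open>f (K @ [j, _])\<close> have vanishing 2 by 2 minors. Both
  rows are nonzero, hence proportional.\<close>

lemma contr_gp_exchange:
  assumes f: "contr_gp {} f" and K: "distinct K" "length K + 2 = rk"
    and ij: "i \<notin> set K" "j \<notin> set K" "i \<noteq> j"
    and ind: "ind (insert i (set K))" "ind (insert j (set K))" "\<not> ind (insert i (insert j (set K)))"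
  shows "proportional E 1 (\<lambda>zs. f ((K @ [i]) @ zs)) (\<lambda>zs. f ((K @ [j]) @ zs))"
proof -
  have E: "set K \<subseteq> E" "i \<in> E" "j \<in> E" using ind_subset_E ind by blast+
  have ex: "\<exists>d\<in>E. f (K @ [u, d]) \<noteq> 0" if u: "u \<notin> set K" "ind (insert u (set K))" for u
  proof -
    have "card (insert u (set K)) < rk" using K u by (simp add: distinct_card)
    then obtain d where d: "d \<in> E - insert u (set K)" "ind (insert d (insert u (set K)))"
      using ind_augment_rk[OF u(2)] by blast
    have t: "K @ [u, d] \<in> tuples E rk" using K E d u ind_subset_E[OF u(2)] by (auto simp: tuples_def)
    have "card (insert d (insert u (set K))) = rk" using K u d by (simp add: distinct_card)
    hence "insert d (insert u (set K)) \<in> Bs" using ind_card_rk[OF d(2)] by simp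
    moreover have "insert d (insert u (set K)) = set (K @ [u, d])" by auto
    ultimately have "f (K @ [u, d]) \<noteq> 0"
      using contr_gp_nonzero[OF f, of "K @ [u, d]"] t u d K by auto
    thus ?thesis using d by blast
  qed
  have "K @ [i, j] \<in> tuples E rk" using K E by (auto simp: tuples_def)
  moreover have "set (K @ [i, j]) \<notin> Bs"
    using ind(3) Bs_ind[of "set (K @ [i, j])"] by (auto simp: insert_commute)
  ultimately have 0: "f (K @ [i, j]) = 0" using contr_gp_nonzero[OF f, of "K @ [i, j]"] by auto
  have cross: "f (K @ [i, c]) * f (K @ [j, d]) = f (K @ [i, d]) * f (K @ [j, c])"
    if "c \<in> E" "d \<in> E" for c d
    using contr_gp_three_term[OF f, of K i j c d] K E that 0 by simp
  obtain c0 where c0: "c0 \<in> E" "f (K @ [i, c0]) \<noteq> 0" using ex[OF ij(1) ind(1)] by blast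
  obtain d where d: "d \<in> E" "f (K @ [j, d]) \<noteq> 0" using ex[OF ij(2) ind(2)] by blast
  \<comment> \<open>Ratio in a column \<open>d\<close> where the row of \<open>j\<close> is nonzero;
    comparison with the column \<open>c0\<close> shows that the row of \<open>i\<close> is nonzero
    there too.\<close>
  define a where "a = f (K @ [i, d]) * inverse (f (K @ [j, d]))"
  have "f (K @ [i, d]) \<noteq> 0" using cross[OF c0(1) d(1)] c0 d by auto
  hence "a \<noteq> 0" using d by (simp add: a_def tract_inverse_nonzero)
  moreover have "f (K @ [i, c]) = a * f (K @ [j, c])" if "c \<in> E" for c
  proof -
    have "f (K @ [j, d]) * (a * f (K @ [j, c])) =
        (f (K @ [j, d]) * inverse (f (K @ [j, d]))) * (f (K @ [i, d]) * f (K @ [j, c]))"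
      unfolding a_def by (simp only: ac_simps)
    also have "\<dots> = f (K @ [j, d]) * f (K @ [i, c])"
      using cross[OF that d(1)] d by (simp add: tract_inverse_right mult.commute)
    finally show ?thesis using d tract_mult_left_cancel by metis
  qed
  ultimately show ?thesis
    unfolding proportional_def by (intro exI[of _ a]) (auto simp: tuples_def length_Suc_conv)
qed

text \<open>Elements of \<open>xs\<close> outside \<open>ys\<close> are exchanged one by one for
  elements of \<open>ys\<close> without leaving the hyperplane, each time by
  \<open>contr_gp_exchange\<close>. The rank-one quotient by a hyperplane thus has a well-defined
  class.\<close>

lemma contr_gp_hyperplane:
  assumes f: "contr_gp {} f" and ys: "distinct ys" "length ys + 1 = rk" "ind (set ys)"
  shows "distinct xs \<Longrightarrow> length xs + 1 = rk \<Longrightarrow> ind (set xs) \<Longrightarrow> set ys \<subseteq> span (set xs) \<Longrightarrow>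
    proportional E 1 (\<lambda>zs. f (xs @ zs)) (\<lambda>zs. f (ys @ zs))"
proof (induction "card (set xs - set ys)" arbitrary: xs rule: less_induct)
  case less
  have cards: "card (set xs) + 1 = rk" "card (set ys) + 1 = rk"
    using less.prems ys by (simp_all add: distinct_card)
  show ?case
  proof (cases "set xs - set ys = {}")
    case True
    hence "set xs = set ys" using cards by (intro card_subset_eq) auto
    thus ?thesis
      using contr_gp_reorder[OF f less.prems(1) ys(1) _ ind_subset_E[OF ys(3)] ys(2)] by simp
  next
    case False
    then obtain i where i: "i \<in> set xs" "i \<notin> set ys" by blast
    define K where "K = remove1 i xs"
    have "0 < length xs" using i(1) by (rule length_pos_if_in_set)
    hence K: "set K = set xs - {i}" "distinct K" "length K + 1 = length xs" "i \<notin> set K"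
      using i less.prems(1) unfolding K_def
      by (auto simp: length_remove1)
    have xs: "insert i (set K) = set xs" using K i by blast
    have "card (set K) < card (set ys)" 
      using distinct_card[OF K(2)] K(3) less.prems(2) cards by linarith
    then obtain j where j: "j \<in> set ys - set K" "ind (insert j (set K))"
      using ind_augment[of "set K" "set ys"] ys K less.prems ind_mono[of "set xs" "set K"] by blast
    have ji: "j \<noteq> i" "j \<notin> set xs" using j i K by auto
    \<comment> \<open>\<open>j\<close> lies in the closure of \<open>xs\<close>, which is
      \<open>K\<close> together with \<open>i\<close>; hence \<open>i\<close> and \<open>j\<close>
      are parallel over \<open>K\<close>.\<close>
    have "insert i (insert j (set K)) = insert j (set xs)" using xs by blast
    hence dep: "\<not> ind (insert i (insert j (set K)))"
      using ji j less.prems(4) unfolding span_def by auto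
    have "proportional E 1 (\<lambda>zs. f (xs @ zs)) (\<lambda>zs. f ((K @ [i]) @ zs))"
      using K xs less.prems(2) ind_subset_E[OF less.prems(3)]
      by (intro contr_gp_reorder[OF f less.prems(1)]) auto
    also have "proportional E 1 (\<lambda>zs. f ((K @ [i]) @ zs)) (\<lambda>zs. f ((K @ [j]) @ zs))"
      using K j ji dep less.prems xs by (intro contr_gp_exchange[OF f]) auto
    also have "proportional E 1 (\<lambda>zs. f ((K @ [j]) @ zs)) (\<lambda>zs. f (ys @ zs))"
    proof (rule less.hyps)
      have "set (K @ [j]) - set ys = (set xs - set ys) - {i}" using K j by auto
      thus "card (set (K @ [j]) - set ys) < card (set xs - set ys)"
        using i by (metis DiffI List.finite_set card_Diff1_less finite_Diff)
      have "set xs \<subseteq> span (set xs)" using ind_subset_E[OF less.prems(3)] unfolding span_def by blast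
      moreover have "card (set xs) = card (set (K @ [j]))"
        using distinct_card[OF less.prems(1)] distinct_card[of "K @ [j]"] K j by simp
      ultimately have "span (set (K @ [j])) = span (set xs)"
        using j K less.prems by (intro span_eqI) auto
      thus "set ys \<subseteq> span (set (K @ [j]))" using less.prems by simp
    qed (use K j less.prems in auto)
    finally show ?thesis .
  qed
qed

text \<open>Descending induction on the length of an independent prefix: hyperplanes start it, and
  \<open>contr_gp_proportional_glue\<close> removes one prefix entry at a time. In rank zero there
  are no hyperplanes, and each function is a single nonzero value.\<close>

lemma contr_gp_unique:
  assumes f: "contr_gp {} f" and g: "contr_gp {} g"
    and loc: "\<And>xs. distinct xs \<Longrightarrow> ind (set xs) \<Longrightarrow> length xs + 1 = rk \<Longrightarrow>
      proportional E 1 (\<lambda>zs. f (xs @ zs)) (\<lambda>zs. g (xs @ zs))"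
  shows "proportional E rk f g"
proof (cases "rk = 0")
  case True
  hence "[] \<in> tuples E rk" by (simp add: tuples_def)
  moreover have "{} \<in> Bs" using True Bs_iff ind_empty by simp
  ultimately have "f [] \<noteq> 0" "g [] \<noteq> 0"
    using contr_gp_nonzero[OF f, of "[]"] contr_gp_nonzero[OF g, of "[]"] by auto
  thus ?thesis
    unfolding proportional_def using True
    by (intro exI[of _ "f [] * inverse (g [])"])
      (auto simp: tuples_def mult.assoc tract_inverse tract_inverse_nonzero)
next
  case False
  have "distinct xs \<Longrightarrow> ind (set xs) \<Longrightarrow> length xs < rk \<Longrightarrow>
    proportional E (rk - length xs) (\<lambda>zs. f (xs @ zs)) (\<lambda>zs. g (xs @ zs))" for xs
  proof (induction "rk - length xs" arbitrary: xs rule: less_induct)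
    case less
    show ?case
    proof (cases "length xs + 1 = rk")
      case True
      hence "rk - length xs = 1" by simp
      thus ?thesis using loc[of xs] less.prems True by simp
    next
      case False
      have card: "card (set xs) = length xs" using less.prems by (simp add: distinct_card)
      have "proportional E (rk - card (set xs)) (\<lambda>zs. f (xs @ zs)) (\<lambda>zs. g (xs @ zs))"
      proof (rule contr_gp_proportional_glue)
        show "contr_gp (set xs) (\<lambda>zs. f (xs @ zs))" "contr_gp (set xs) (\<lambda>zs. g (xs @ zs))"
          using contr_gp_append[OF f, of xs] contr_gp_append[OF g, of xs] less.prems by auto
        fix x assume "x \<in> points (set xs)"
        thus "proportional E (rk - Suc (card (set xs))) (\<lambda>zs. f (xs @ x # zs)) (\<lambda>zs. g (xs @ x # zs))"
          using less.hyps[of "xs @ [x]"] less.prems False unfolding points_def card by auto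
      qed (use less.prems False card in auto)
      thus ?thesis unfolding card .
    qed
  qed
  from this[of "[]"] show ?thesis using False ind_empty by simp
qed

end

section \<open>Covectors of rank two\<close>

lemma sorted_wrt_unique:
  assumes "antisym R"
  shows "sorted_wrt (\<lambda>x y. (x, y) \<in> R) xs \<Longrightarrow> sorted_wrt (\<lambda>x y. (x, y) \<in> R) ys \<Longrightarrow>
    distinct xs \<Longrightarrow> distinct ys \<Longrightarrow> set xs = set ys \<Longrightarrow> xs = ys"
proof (induction xs arbitrary: ys)
  case (Cons x xs)
  then obtain y ys' where ys: "ys = y # ys'" by (cases ys) auto
  have "x = y"
  proof (rule ccontr)
    assume "x \<noteq> y"
    hence "x \<in> set ys'" "y \<in> set xs" using Cons.prems(5) ys by auto
    thus False using Cons.prems ys \<open>x \<noteq> y\<close> antisymD[OF assms] by auto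
  qed
  moreover have "xs = ys'" using Cons.prems ys \<open>x = y\<close> by (intro Cons.IH) auto
  ultimately show ?case using ys by simp
qed simp

lemma sorted_list_exists:
  assumes R: "linear_order_on E R" and "finite A" "A \<subseteq> E"
  shows "\<exists>ys. sorted_wrt (\<lambda>x y. (x, y) \<in> R) ys \<and> distinct ys \<and> set ys = A"
  using assms(2,3)
proof (induction A rule: finite_induct)
  case (insert a A)
  then obtain ys where ys: "sorted_wrt (\<lambda>x y. (x, y) \<in> R) ys" "distinct ys" "set ys = A" by auto
  have R': "trans R" "total_on E R" using R by (auto simp: order_on_defs)
  let ?us = "filter (\<lambda>y. (y, a) \<in> R) ys" and ?vs = "filter (\<lambda>y. (y, a) \<notin> R) ys"
  have av: "(a, v) \<in> R" if "v \<in> set ?vs" for v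
  proof -
    have "v \<in> A" "(v, a) \<notin> R" using that ys by auto
    thus ?thesis using R'(2) insert.hyps(2) insert.prems unfolding total_on_def by auto
  qed
  have "sorted_wrt (\<lambda>x y. (x, y) \<in> R) (?us @ a # ?vs)"
    using ys av transD[OF R'(1)] by (auto simp: sorted_wrt_append sorted_wrt_filter intro: transD[OF R'(1)])
  moreover have "distinct (?us @ a # ?vs)" "set (?us @ a # ?vs) = insert a A"
    using ys insert by auto
  ultimately show ?case by blast
qed simp

text \<open>Justifies the definite description in \<open>sorting_perm\<close>: a linear order sorts
  a finite set in one way only, and distinct entries recover the permutation from the sorted
  list.\<close>

lemma sorting_perm_unique:
  assumes R: "linear_order_on E R" and xs: "distinct xs" "set xs \<subseteq> E"
  shows "\<exists>!p. p permutes {..<length xs} \<and> sorted_wrt (\<lambda>x y. (x, y) \<in> R) (permute_list p xs)"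
proof (rule ex_ex1I)
  obtain ys where ys: "sorted_wrt (\<lambda>x y. (x, y) \<in> R) ys" "distinct ys" "set ys = set xs"
    using sorted_list_exists[OF R, of "set xs"] xs by auto
  hence "mset ys = mset xs" using xs set_eq_iff_mset_eq_distinct by blast
  then obtain p where "p permutes {..<length xs}" "permute_list p xs = ys"
    by (rule mset_eq_permutation)
  thus "\<exists>p. p permutes {..<length xs} \<and> sorted_wrt (\<lambda>x y. (x, y) \<in> R) (permute_list p xs)"
    using ys by blast
next
  fix p q
  assume p: "p permutes {..<length xs} \<and> sorted_wrt (\<lambda>x y. (x, y) \<in> R) (permute_list p xs)"
    and q: "q permutes {..<length xs} \<and> sorted_wrt (\<lambda>x y. (x, y) \<in> R) (permute_list q xs)"
  have "antisym R" using R by (simp add: order_on_defs)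
  hence eq: "permute_list p xs = permute_list q xs"
    using p q xs by (intro sorted_wrt_unique) auto
  show "p = q"
  proof
    fix k
    show "p k = q k"
    proof (cases "k < length xs")
      case True
      have "xs ! p k = xs ! q k"
        using eq True p q permute_list_nth[of p xs k] permute_list_nth[of q xs k] by simp
      moreover have "p k < length xs" "q k < length xs"
        using True p q permutes_in_image[of p _ k] permutes_in_image[of q _ k] by auto
      ultimately show ?thesis using xs(1) nth_eq_iff_index_eq by blast
    next
      case False
      thus ?thesis using p q by (metis lessThan_iff permutes_not_in)
    qed
  qed
qed

text \<open>A transposition followed by sorting of the swapped list sorts the original one, so by
  uniqueness the two sorting permutations differ by a transposition.\<close>

lemma sorting_perm_swap:
  assumes R: "linear_order_on E R" and xs: "distinct (us @ x # y # vs)" "set (us @ x # y # vs) \<subseteq> E"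
  shows "tract_sign (sorting_perm R (us @ y # x # vs)) =
    (- tract_sign (sorting_perm R (us @ x # y # vs)) :: 't::tract)"
proof -
  let ?xs = "us @ x # y # vs" and ?ys = "us @ y # x # vs"
  let ?t = "transpose (length us) (Suc (length us))"
  let ?q = "sorting_perm R ?ys"
  have ys: "distinct ?ys" "set ?ys \<subseteq> E" using xs by auto
  have q: "?q permutes {..<length ?ys} \<and> sorted_wrt (\<lambda>x y. (x, y) \<in> R) (permute_list ?q ?ys)"
    using theI'[OF sorting_perm_unique[OF R ys]] unfolding sorting_perm_def .
  have t: "?t permutes {..<length ?xs}" by (rule permutes_swap_id) auto
  have tq: "?t \<circ> ?q permutes {..<length ?xs}" using permutes_compose[OF _ t] q by simp
  have "permute_list (?t \<circ> ?q) ?xs = permute_list ?q ?ys"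
    using permute_list_compose[of ?q ?xs ?t] permute_list_transpose[of us "[]" x y vs] q by simp
  hence "sorting_perm R ?xs = ?t \<circ> ?q"
    unfolding sorting_perm_def[of R ?xs]
    using tq q by (intro the1_equality[OF sorting_perm_unique[OF R xs]]) simp
  moreover have "permutation ?q" using q permutes_imp_permutation by blast
  ultimately show ?thesis
    by (simp add: tract_sign_compose tract_sign_transpose permutation_swap_id del: o_apply)
qed

section \<open>The dual of a rank-two function\<close>

text \<open>The unspecified listing of the complement is \<open>[b, c]\<close> or
  \<open>[c, b]\<close>; passing from one to the other changes the sign of the sorting permutation
  and of \<open>\<psi>\<close> alike.\<close>

lemma gp_dual_rank2:
  fixes \<psi> :: "'e list \<Rightarrow> 't::tract"
  assumes R: "linear_order_on E R" and \<psi>: "swap_neg E 2 \<psi>" and ds: "ds \<in> tuples E (card E - 2)" "distinct ds"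
    and bc: "E - set ds = {b, c}" "b \<noteq> c"
  shows "gp_dual E R 2 \<psi> ds = tract_sign (sorting_perm R (ds @ [b, c])) * \<psi> [b, c]"
proof -
  define es where "es = (SOME es. distinct es \<and> set es = E - set ds)"
  have "distinct es \<and> set es = E - set ds"
    unfolding es_def by (rule someI[of _ "[b, c]"]) (use bc in auto)
  hence es: "distinct es" "set es = {b, c}" using bc by auto
  hence "length es = Suc (Suc 0)" using bc distinct_card[of es] by simp
  then obtain u v where "es = [u, v]" by (metis length_0_conv length_Suc_conv)
  hence cases: "es = [b, c] \<or> es = [c, b]" using es by (auto simp: doubleton_eq_iff)
  have E: "b \<in> E" "c \<in> E" "b \<notin> set ds" "c \<notin> set ds" "set ds \<subseteq> E" using bc ds by (auto simp: tuples_def)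
  have "tract_sign (sorting_perm R (ds @ [c, b])) = (- tract_sign (sorting_perm R (ds @ [b, c])) :: 't)"
    by (rule sorting_perm_swap[OF R]) (use E ds bc in auto)
  moreover have "\<psi> [c, b] = - \<psi> [b, c]"
    using swap_negD[OF \<psi>, of "[]" c b "[]"] E by (simp add: tuples_def)
  ultimately have "tract_sign (sorting_perm R (ds @ [c, b])) * \<psi> [c, b] =
      tract_sign (sorting_perm R (ds @ [b, c])) * \<psi> [b, c]"
    by simp
  moreover have "gp_dual E R 2 \<psi> ds = tract_sign (sorting_perm R (ds @ es)) * \<psi> es"
    using ds by (simp add: gp_dual_def es_def Let_def)
  ultimately show ?thesis using cases by auto
qed

text \<open>For \<open>e\<close> in \<open>ds\<close> the dual vanishes on a repeated entry, so
  three terms remain. Bringing \<open>a\<close>, \<open>b\<close> or \<open>c\<close> to the front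
  of the triple costs 0, 1 or 2 swaps, which gives alternating signs up to the common factor
  \<open>\<epsilon>\<close>.\<close>

lemma dual_sum_rank2:
  assumes R: "linear_order_on E R" and fin: "finite E" and \<psi>: "swap_neg E 2 \<psi>"
    and ds: "distinct ds" "set ds \<subseteq> E" "length ds + 1 = card E - 2"
    and abc: "E - set ds = {a, b, c}" "a \<noteq> b" "a \<noteq> c" "b \<noteq> c"
  shows "(\<Sum>e\<in>E. formal (Y e * gp_dual E R 2 \<psi> (ds @ [e]))) \<in> null \<longleftrightarrow>
    three_term (Y a * \<psi> [b, c]) (Y b * \<psi> [a, c]) (Y c * \<psi> [a, b])"
proof -
  let ?D = "\<lambda>e. gp_dual E R 2 \<psi> (ds @ [e])"
  let ?\<sigma> = "\<lambda>xs. tract_sign (sorting_perm R xs) :: 'b"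
  define \<epsilon> where "\<epsilon> = ?\<sigma> (ds @ [a, b, c])"
  have E: "a \<in> E" "b \<in> E" "c \<in> E" "a \<notin> set ds" "b \<notin> set ds" "c \<notin> set ds" using abc by auto
  have t: "ds @ [e] \<in> tuples E (card E - 2)" if "e \<in> E" for e using ds that by (simp add: tuples_def)
  have D0: "?D e = 0" if "e \<in> set ds" for e
    using t[of e] that ds unfolding gp_dual_def by auto
  have Da: "?D a = \<epsilon> * \<psi> [b, c]"
    using gp_dual_rank2[OF R \<psi> t[OF E(1)], of b c] abc ds E by (auto simp: \<epsilon>_def)
  have \<sigma>b: "?\<sigma> (ds @ [b, a, c]) = - \<epsilon>"
    using sorting_perm_swap[OF R, of ds a b "[c]"] abc ds E by (auto simp: \<epsilon>_def)
  hence Db: "?D b = - \<epsilon> * \<psi> [a, c]"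
    using gp_dual_rank2[OF R \<psi> t[OF E(2)], of a c] abc ds E by auto
  have "?\<sigma> (ds @ [a, c, b]) = - \<epsilon>"
    using sorting_perm_swap[OF R, of "ds @ [a]" b c "[]"] abc ds E by (auto simp: \<epsilon>_def)
  moreover have "?\<sigma> (ds @ [c, a, b]) = - ?\<sigma> (ds @ [a, c, b])"
    using sorting_perm_swap[OF R, of ds a c "[b]"] abc ds E by auto
  ultimately have Dc: "?D c = \<epsilon> * \<psi> [a, b]"
    using gp_dual_rank2[OF R \<psi> t[OF E(3)], of a b] abc ds E by auto
  have "(\<Sum>e\<in>E. formal (Y e * ?D e)) = (\<Sum>e\<in>{a, b, c}. formal (Y e * ?D e))"
  proof (rule sum.mono_neutral_right[OF fin])
    show "\<forall>e\<in>E - {a, b, c}. formal (Y e * ?D e) = {#}"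
    proof
      fix e assume "e \<in> E - {a, b, c}"
      hence "e \<in> set ds" using abc(1) by blast
      thus "formal (Y e * ?D e) = {#}" using D0 by simp
    qed
  qed (use E in simp)
  also have "\<dots> = formal (\<epsilon> * (Y a * \<psi> [b, c])) + formal (- (\<epsilon> * (Y b * \<psi> [a, c]))) +
      formal (\<epsilon> * (Y c * \<psi> [a, b]))"
    using abc by (simp add: Da Db Dc ac_simps)
  finally have "(\<Sum>e\<in>E. formal (Y e * ?D e)) \<in> null \<longleftrightarrow>
      three_term (\<epsilon> * (Y a * \<psi> [b, c])) (\<epsilon> * (Y b * \<psi> [a, c])) (\<epsilon> * (Y c * \<psi> [a, b]))"
    unfolding three_term_def by simp
  also have "\<dots> \<longleftrightarrow> three_term (Y a * \<psi> [b, c]) (Y b * \<psi> [a, c]) (Y c * \<psi> [a, b])"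
    by (rule three_term_scale) (simp add: \<epsilon>_def tract_sign_nonzero)
  finally show ?thesis .
qed

text \<open>Each condition on a vector of the dual fixes a tuple of \<open>card E - 3\<close>
  elements. A distinct tuple leaves out an arbitrary triple and yields its relation; a tuple with
  repetitions yields an empty sum.\<close>

lemma covectors_rank2:
  assumes fin: "finite E" and \<psi>: "swap_neg E 2 \<psi>"
  shows "Y \<in> covectors E 2 \<psi> \<longleftrightarrow> Y \<in> E \<rightarrow>\<^sub>E UNIV \<and>
    (\<forall>a\<in>E. \<forall>b\<in>E. \<forall>c\<in>E. a \<noteq> b \<and> a \<noteq> c \<and> b \<noteq> c \<longrightarrow>
      three_term (Y a * \<psi> [b, c]) (Y b * \<psi> [a, c]) (Y c * \<psi> [a, b]))"
    (is "_ \<longleftrightarrow> ?ext \<and> ?rel")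
proof
  assume "Y \<in> covectors E 2 \<psi>"
  then obtain R where R: "linear_order_on E R" and Y: "Y \<in> vectors E (card E - 2) (gp_dual E R 2 \<psi>)"
    unfolding covectors_def by blast
  have ?rel
  proof (intro ballI impI)
    fix a b c assume abc: "a \<in> E" "b \<in> E" "c \<in> E" "a \<noteq> b \<and> a \<noteq> c \<and> b \<noteq> c"
    obtain ds where ds: "set ds = E - {a, b, c}" "distinct ds"
      using finite_distinct_list[of "E - {a, b, c}"] fin by auto
    have "length ds = card (E - {a, b, c})" using ds distinct_card by metis
    also have "\<dots> = card E - 3" using abc fin by (subst card_Diff_subset) auto
    finally have "length ds = card E - 3" .
    \<comment> \<open>Three distinct elements make the truncated subtractions exact.\<close>
    moreover have "3 \<le> card E" using card_mono[OF fin, of "{a, b, c}"] abc by simp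
    ultimately have len: "length ds + 1 = card E - 2" by simp
    hence "(\<Sum>e\<in>E. formal (Y e * gp_dual E R 2 \<psi> (ds @ [e]))) \<in> null"
      using Y ds unfolding vectors_def by auto
    thus "three_term (Y a * \<psi> [b, c]) (Y b * \<psi> [a, c]) (Y c * \<psi> [a, b])"
      using dual_sum_rank2[OF R fin \<psi> ds(2) _ len, of a b c Y] ds abc by auto
  qed
  thus "?ext \<and> ?rel" using Y unfolding vectors_def by blast
next
  assume Y: "?ext \<and> ?rel"
  \<comment> \<open>The well-ordering theorem supplies an order for the existential in
    \<open>covectors\<close>; every order yields the same relations.\<close>
  obtain R where "well_order_on E R" using well_order_on by blast
  hence R: "linear_order_on E R" unfolding well_order_on_def by blast
  have "(\<Sum>e\<in>E. formal (Y e * gp_dual E R 2 \<psi> (ds @ [e]))) \<in> null"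
    if ds: "length ds + 1 = card E - 2 \<and> set ds \<subseteq> E" for ds
  proof (cases "distinct ds")
    case True
    have "card (E - set ds) = card E - length ds"
      using ds True by (simp add: card_Diff_subset distinct_card)
    moreover have "length ds + 1 = card E - 2" using ds by simp
    ultimately have "card (E - set ds) = 3" by linarith
    then obtain a b c where abc: "E - set ds = {a, b, c}" "a \<noteq> b" "a \<noteq> c" "b \<noteq> c"
      by (auto simp: card_3_iff)
    hence "a \<in> E" "b \<in> E" "c \<in> E" by auto
    thus ?thesis using dual_sum_rank2[OF R fin \<psi> True, of a b c Y] abc ds Y by simp
  next
    case False
    have "gp_dual E R 2 \<psi> (ds @ [e]) = 0" if "e \<in> E" for e
      using that ds False unfolding gp_dual_def by (simp add: tuples_def)
    thus ?thesis by (simp add: null_empty)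
  qed
  thus "Y \<in> covectors E 2 \<psi>" unfolding covectors_def vectors_def using R Y by blast
qed

section \<open>Quotients of rank one\<close>

text \<open>In rank one a hyperplane is spanned by the empty set, so the set of loops is the only
  one.\<close>

lemma rank1_hyperplane:
  fixes f :: "'e list \<Rightarrow> 't::tract"
  assumes f: "gp_function E 1 f"
  shows "hyperplanes E (gp_bases E 1 f) = {{e \<in> E. f [e] = 0}}"
    and "mclosure E (gp_bases E 1 f) {} = {e \<in> E. f [e] = 0}"
    and "\<exists>e\<in>E. f [e] \<noteq> 0"
proof -
  let ?B = "gp_bases E 1 f"
  have B: "?B = {{e} |e. e \<in> E \<and> f [e] \<noteq> 0}"
  proof (intro subset_antisym subsetI)
    fix X assume "X \<in> ?B"
    then obtain es where "X = set es" "es \<in> tuples E 1" "f es \<noteq> 0" unfolding gp_bases_def by auto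
    moreover from this obtain e where "es = [e]" by (auto simp: tuples_def length_Suc_conv)
    ultimately show "X \<in> {{e} |e. e \<in> E \<and> f [e] \<noteq> 0}" by (auto simp: tuples_def)
  next
    fix X assume "X \<in> {{e} |e. e \<in> E \<and> f [e] \<noteq> 0}"
    then obtain e where "X = {e}" "e \<in> E" "f [e] \<noteq> 0" by blast
    thus "X \<in> ?B" unfolding gp_bases_def by (intro CollectI exI[of _ "[e]"]) (auto simp: tuples_def)
  qed
  interpret M1: basis_matroid E ?B
    using f unfolding gp_function_def basis_matroid_def by blast
  obtain X where X: "X \<in> ?B" using M1.Bs_ne by blast
  thus "\<exists>e\<in>E. f [e] \<noteq> 0" using B by auto
  have rk: "M1.rk = 1" using M1.card_Bs[OF X] X B by auto
  have "indep ?B {e} \<longleftrightarrow> e \<in> E \<and> f [e] \<noteq> 0" for e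
    unfolding indep_def B by auto
  hence span: "M1.span {} = {e \<in> E. f [e] = 0}" unfolding M1.span_def by auto
  show "mclosure E ?B {} = {e \<in> E. f [e] = 0}"
    using M1.mclosure_eq_span[OF M1.basis_of_self[OF M1.ind_empty]] span by simp
  have "I = {}" if "indep ?B I" "card I + 1 = M1.rk" for I
    using that M1.finite_ind[of I] rk by simp
  hence "H \<in> hyperplanes E ?B \<longleftrightarrow> H = M1.span {}" for H
    unfolding M1.hyperplane_iff using M1.ind_empty rk by (metis add_0 card.empty)
  thus "hyperplanes E ?B = {{e \<in> E. f [e] = 0}}"
    unfolding span by blast
qed

lemma hyperplane_function_iff:
  assumes "hyperplane_function E H (\<lambda>e\<in>E. f [e])" "e \<in> E"
  shows "f [e] \<noteq> 0 \<longleftrightarrow> e \<notin> H"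
proof -
  have "{e \<in> E. (\<lambda>e\<in>E. f [e]) e \<noteq> 0} = E - H"
    using assms(1) unfolding hyperplane_function_def by blast
  from eqset_imp_iff[OF this, of e] show ?thesis using assms(2) by simp
qed

text \<open>The rank-one matroid has a single hyperplane \<open>L\<close>. Correspondence forces
  \<open>\<eta> L\<close> to be a unit multiple of \<open>f\<close>, so being a quotient means that
  \<open>f\<close> is a covector of \<open>\<psi>\<close>.\<close>

lemma matroid_quotient_rank1:
  fixes f \<psi> :: "'e list \<Rightarrow> 't::tract"
  assumes fin: "finite E" and f: "gp_function E 1 f" and \<psi>: "swap_neg E 2 \<psi>"
  shows "matroid_quotient E 1 f 2 \<psi> \<longleftrightarrow>
    (\<forall>a\<in>E. \<forall>b\<in>E. \<forall>c\<in>E. a \<noteq> b \<and> a \<noteq> c \<and> b \<noteq> c \<longrightarrow>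
      three_term (f [a] * \<psi> [b, c]) (f [b] * \<psi> [a, c]) (f [c] * \<psi> [a, b]))"
    (is "_ \<longleftrightarrow> ?rel")
proof
  let ?B = "gp_bases E 1 f"
  define L where "L = {e \<in> E. f [e] = 0}"
  have hyp: "hyperplanes E ?B = {L}" "mclosure E ?B {} = L"
    using rank1_hyperplane[OF f] unfolding L_def by auto
  obtain e0 where e0: "e0 \<in> E" "f [e0] \<noteq> 0" using rank1_hyperplane(3)[OF f] by blast
  {
    assume "matroid_quotient E 1 f 2 \<psi>"
    then obtain \<eta> where \<eta>: "T_representation E ?B \<eta>" "corresponds E ?B \<eta> 1 f"
      "\<eta> ` hyperplanes E ?B \<subseteq> covectors E 2 \<psi>"
      unfolding matroid_quotient_def by blast
    have "hyperplane_function E L (\<eta> L)" using \<eta>(1) hyp(1) unfolding T_representation_def by simp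
    hence supp: "{e \<in> E. \<eta> L e \<noteq> 0} = E - L" unfolding hyperplane_function_def by simp
    have ratio: "\<eta> L d / \<eta> L e = f [d] / f [e]" if "d \<in> E - L" "e \<in> E - L" for d e
    proof -
      have "\<forall>H\<in>hyperplanes E ?B. \<forall>is. length is + 1 = 1 \<and> set is \<subseteq> H \<and> mclosure E ?B (set is) = H \<longrightarrow>
        (\<forall>d\<in>E - H. \<forall>e\<in>E - H. \<eta> H d / \<eta> H e = f (is @ [d]) / f (is @ [e]))"
        using \<eta>(2) unfolding corresponds_def by blast
      from this[rule_format, of L "[]" d e] show ?thesis using hyp that by simp
    qed
    have \<eta>0: "\<eta> L e0 \<noteq> 0" using supp e0 unfolding L_def by blast
    \<comment> \<open>The scalar is read off at one nonloop \<open>e0\<close>; the ratios in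
      \<open>corresponds\<close> carry it to all others.\<close>
    define k where "k = \<eta> L e0 * inverse (f [e0])"
    have k: "k \<noteq> 0" using \<eta>0 e0 by (simp add: k_def tract_inverse_nonzero)
    have \<eta>k: "\<eta> L d = k * f [d]" if d: "d \<in> E" for d
    proof (cases "d \<in> L")
      case True
      hence "\<eta> L d = 0" using supp d by blast
      thus ?thesis using True by (simp add: L_def)
    next
      case False
      have "\<eta> L d * inverse (\<eta> L e0) = f [d] * inverse (f [e0])"
        using ratio[of d e0] d False e0 unfolding L_def tract_divide by simp
      moreover have "\<eta> L d = \<eta> L e0 * (\<eta> L d * inverse (\<eta> L e0))"
        using tract_inverse_right[OF \<eta>0] by (metis mult.left_commute mult.right_neutral)
      ultimately show ?thesis unfolding k_def by (simp add: ac_simps)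
    qed
    have "\<eta> L \<in> covectors E 2 \<psi>" using \<eta>(3) hyp(1) by simp
    hence cov: "\<forall>a\<in>E. \<forall>b\<in>E. \<forall>c\<in>E. a \<noteq> b \<and> a \<noteq> c \<and> b \<noteq> c \<longrightarrow>
      three_term (\<eta> L a * \<psi> [b, c]) (\<eta> L b * \<psi> [a, c]) (\<eta> L c * \<psi> [a, b])"
      unfolding covectors_rank2[OF fin \<psi>] by (rule conjunct2)
    show ?rel
    proof (intro ballI impI)
      fix a b c assume abc: "a \<in> E" "b \<in> E" "c \<in> E" "a \<noteq> b \<and> a \<noteq> c \<and> b \<noteq> c"
      from cov[rule_format, OF abc] show "three_term (f [a] * \<psi> [b, c]) (f [b] * \<psi> [a, c]) (f [c] * \<psi> [a, b])"
        using abc by (simp add: \<eta>k mult.assoc three_term_scale[OF k])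
    qed
  }
  assume rel: ?rel
  let ?\<eta> = "\<lambda>_. (\<lambda>e\<in>E. f [e])"
  show "matroid_quotient E 1 f 2 \<psi>"
    unfolding matroid_quotient_def
  proof (intro exI[of _ ?\<eta>] conjI)
    \<comment> \<open>With one hyperplane, the condition on three distinct ones is vacuous.\<close>
    show "T_representation E ?B ?\<eta>"
      unfolding T_representation_def hyp(1) by (auto simp: hyperplane_function_def L_def)
    show "corresponds E ?B ?\<eta> 1 f"
      unfolding corresponds_def by auto
    show "?\<eta> ` hyperplanes E ?B \<subseteq> covectors E 2 \<psi>"
      unfolding hyp(1) using covectors_rank2[OF fin \<psi>, of "\<lambda>e\<in>E. f [e]"] rel by simp
  qed
qed

lemma gp_function_swap_neg: "gp_function E s f \<Longrightarrow> swap_neg E s f"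
  unfolding gp_function_def using alternating_swap_neg by blast

lemma proportional_restrict [simp]:
  "proportional E s (restrict f (tuples E s)) g = proportional E s f g"
  "proportional E s f (restrict g (tuples E s)) = proportional E s f g"
  unfolding proportional_def by auto

context basis_matroid
begin

section \<open>From a representation on flats of small corank to a Grassmann-Pluecker function\<close>

lemma not_span_iff:
  assumes "e \<in> E"
  shows "e \<notin> span I \<longleftrightarrow> e \<in> points I"
  using assms unfolding span_def points_def by blast

lemma span_insert_subset: "span I \<subseteq> span (insert e I)"
  using span_mono_insert by blast

text \<open>(\<Lambda>R1) fixes the support; in rank one neither swaps nor three-term relations
  occur.\<close>

lemma Lambda2_corank1:
  assumes L: "Lambda2_representation E Bs \<psi>" and I: "ind I" "card I + 1 = rk"
  shows "contr_gp I (\<psi> (span I))"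
proof -
  have "span I \<in> hyperplanes E Bs" using hyperplane_iff I by blast
  hence hf: "hyperplane_function E (span I) (\<lambda>e\<in>E. \<psi> (span I) [e])"
    using L unfolding Lambda2_representation_def by blast
  have s: "rk - card I = 1" using I by simp
  have supp: "\<psi> (span I) [e] \<noteq> 0 \<longleftrightarrow> e \<notin> I \<and> insert e I \<in> Bs" if e: "e \<in> E" for e
  proof -
    have "\<psi> (span I) [e] \<noteq> 0 \<longleftrightarrow> e \<in> points I" 
      using hyperplane_function_iff[OF hf e] not_span_iff[OF e] by blast
    thus ?thesis using card_insert_points[of e I] I Bs_iff unfolding points_def by auto
  qed
  show ?thesis
    unfolding contr_gp_def s
  proof (intro conjI ballI)
    fix xs assume "xs \<in> tuples E 1"
    then obtain e where "xs = [e]" "e \<in> E" by (auto simp: tuples_def length_Suc_conv)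
    thus "\<psi> (span I) xs \<noteq> 0 \<longleftrightarrow> distinct xs \<and> set xs \<inter> I = {} \<and> I \<union> set xs \<in> Bs"
      using supp[of e] by simp
  qed (auto simp: swap_neg_def tuples_def)
qed

text \<open>(\<Lambda>R2) gives three-term relations between the function \<open>?f\<close> of the
  flat and the hyperplane functions \<open>?Y x\<close> above it. They force the row
  \<open>?f [e, _]\<close> to vanish when \<open>e\<close> is a loop, and to be a multiple of the
  function of the hyperplane through \<open>e\<close> otherwise; the support of \<open>?f\<close>
  follows.\<close>

lemma Lambda2_corank2:
  assumes L: "Lambda2_representation E Bs \<psi>" and I: "ind I" "card I + 2 = rk"
  shows "contr_gp I (\<psi> (span I))"
    and "x \<in> points I \<Longrightarrow> proportional E 1 (\<lambda>xs. \<psi> (span I) (x # xs)) (\<psi> (span (insert x I)))"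
proof -
  let ?f = "\<psi> (span I)"
  let ?Y = "\<lambda>x. \<psi> (span (insert x I))"
  have F: "span I \<in> flats E Bs" "corank E Bs (span I) = 2"
    using span_flat corank_span I by auto
  hence gp: "gp_function E 2 ?f"
    using L unfolding Lambda2_representation_def flats_le2_def by force
  note sw = gp_function_swap_neg[OF gp]
  have alt: "?f [a, a] = 0" if "a \<in> E" for a
    using gp that unfolding gp_function_def alternating_def by (auto simp: tuples_def)
  have sw': "?f [a, b] = - ?f [b, a]" if "a \<in> E" "b \<in> E" for a b
    using swap_negD[OF sw, of "[]" a b "[]"] that by (simp add: tuples_def)
  have card: "card (insert x I) + 1 = rk" "ind (insert x I)" if "x \<in> points I" for x
    using card_insert_points[OF that] I that unfolding points_def by auto
  have Y0: "?Y x [e] \<noteq> 0 \<longleftrightarrow> e \<notin> span (insert x I)" if "x \<in> points I" "e \<in> E" for x e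
  proof -
    have "span (insert x I) \<in> hyperplanes E Bs" using hyperplane_iff card[OF that(1)] by blast
    hence "hyperplane_function E (span (insert x I)) (\<lambda>e\<in>E. ?Y x [e])"
      using L unfolding Lambda2_representation_def by blast
    from hyperplane_function_iff[OF this that(2)] show ?thesis .
  qed
  have rel: "three_term (?Y x [a] * ?f [b, c]) (?Y x [b] * ?f [a, c]) (?Y x [c] * ?f [a, b])"
    if x: "x \<in> points I" and abc: "a \<in> E" "b \<in> E" "c \<in> E" "a \<noteq> b" "a \<noteq> c" "b \<noteq> c" for x a b c
  proof -
    have H: "span (insert x I) \<in> hyperplanes E Bs" using hyperplane_iff card[OF x] by blast
    hence "gp_function E 1 (?Y x)"
      using L unfolding Lambda2_representation_def flats_le2_def hyperplanes_def by force
    moreover have "matroid_quotient E 1 (?Y x) 2 ?f"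
      using L H F span_insert_subset unfolding Lambda2_representation_def by blast
    ultimately show ?thesis using matroid_quotient_rank1[OF finite_E _ sw] abc by blast
  qed
  \<comment> \<open>For \<open>e\<close> in the hyperplane of \<open>x\<close> the term with
    \<open>?Y x [e]\<close> drops out, so the row of \<open>e\<close> and \<open>?Y x\<close> have
    vanishing minors; one nonzero entry of the row then gives proportionality.\<close>
  have prop_in: "proportional E 1 (\<lambda>xs. ?f (e # xs)) (?Y x)"
    if x: "x \<in> points I" and e: "e \<in> E" "e \<in> span (insert x I)" and b0: "b0 \<in> E" "?f [e, b0] \<noteq> 0" for x e b0
  proof -
    have Ye: "?Y x [e] = 0" using Y0[OF x e(1)] e(2) by blast
    have cross: "?Y x [a] * ?f [e, b] = ?Y x [b] * ?f [e, a]" if ab: "a \<in> E" "b \<in> E" for a b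
    proof (cases "a = b \<or> a = e \<or> b = e")
      case True
      thus ?thesis using Ye alt e by auto
    next
      case False
      thus ?thesis using rel[OF x e(1) ab] Ye by auto
    qed
    have "card (insert x I) < rk" using card[OF x] by simp
    then obtain a0 where "a0 \<in> E - insert x I" "ind (insert a0 (insert x I))"
      using ind_augment_rk card[OF x] by blast
    hence a0: "a0 \<in> E" "?Y x [a0] \<noteq> 0" using Y0[OF x, of a0] unfolding span_def by auto
    have Yb: "?Y x [b0] \<noteq> 0" using cross[OF a0(1) b0(1)] a0 b0 by auto
    define k where "k = inverse (?Y x [b0]) * ?f [e, b0]"
    have "?f [e, a] = k * ?Y x [a]" if a: "a \<in> E" for a
    proof -
      have "k * ?Y x [a] = inverse (?Y x [b0]) * (?Y x [b0] * ?f [e, a])"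
        unfolding k_def cross[OF a b0(1), symmetric] by (simp only: ac_simps)
      thus ?thesis using tract_inverse[OF Yb] by (metis mult.assoc mult.left_neutral)
    qed
    moreover have "k \<noteq> 0" unfolding k_def using Yb b0 by (simp add: tract_inverse_nonzero)
    ultimately show ?thesis
      unfolding proportional_def by (intro exI[of _ k]) (auto simp: tuples_def length_Suc_conv)
  qed
  have prop_supp: "?f [e, b] \<noteq> 0 \<longleftrightarrow> b \<notin> span (insert x I)"
    if p: "proportional E 1 (\<lambda>xs. ?f (e # xs)) (?Y x)" and x: "x \<in> points I" and b: "b \<in> E" for e x b
  proof -
    obtain k where k: "k \<noteq> 0" "\<And>xs. xs \<in> tuples E 1 \<Longrightarrow> ?f (e # xs) = k * ?Y x xs"
      using p unfolding proportional_def by blast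
    have "?f [e, b] = k * ?Y x [b]" using k(2)[of "[b]"] b by (simp add: tuples_def)
    thus ?thesis using k(1) Y0[OF x b] by simp
  qed
  \<comment> \<open>A loop lies in every hyperplane over the flat, so a nonzero row would have the
    supports of two different hyperplane functions at once.\<close>
  have loop: "?f [e, b] = 0" if e: "e \<in> span I" and b: "b \<in> E" for e b
  proof (rule ccontr)
    assume nz: "?f [e, b] \<noteq> 0"
    have eE: "e \<in> E" using e unfolding span_def by blast
    obtain x where x: "x \<in> points I"
      using ind_augment_rk[OF I(1)] I unfolding points_def by auto
    then obtain y where xy: "adj I y x" using adj_exists[of x I] I by auto
    hence y: "y \<in> points I" using adj_points by blast
    have "proportional E 1 (\<lambda>xs. ?f (e # xs)) (?Y x)" "proportional E 1 (\<lambda>xs. ?f (e # xs)) (?Y y)"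
      using prop_in[OF x eE _ b nz] prop_in[OF y eE _ b nz] e span_insert_subset by blast+
    from prop_supp[OF this(1) x points_in_E[OF y]] prop_supp[OF this(2) y points_in_E[OF y]]
    have "y \<notin> span (insert x I) \<longleftrightarrow> y \<notin> span (insert y I)" by simp
    moreover have "y \<in> span (insert y I)" using points_in_E[OF y] unfolding span_def by blast
    moreover have "y \<notin> span (insert x I)" using xy unfolding span_def adj_def by blast
    ultimately show False by blast
  qed
  \<comment> \<open>If the row of the nonloop \<open>e\<close> vanished, the relation for a
    hyperplane missing \<open>e\<close> would reduce to \<open>?Y w [e] * ?f [a, b] = 0\<close> with
    both factors nonzero.\<close>
  have nonloop: "\<exists>b\<in>E. ?f [e, b] \<noteq> 0" if e: "e \<in> points I" for e
  proof (rule ccontr)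
    assume no: "\<not> ?thesis"
    have eE: "e \<in> E" using points_in_E[OF e] .
    obtain w where w: "adj I e w" using adj_exists[OF e] adj_points I by (metis order_refl)
    hence wP: "w \<in> points I" using adj_points by blast
    have "e \<notin> span (insert w I)" using w unfolding span_def adj_def by blast
    hence Ye: "?Y w [e] \<noteq> 0" using Y0[OF wP eE] by blast
    have "gp_bases E 2 ?f \<noteq> {}" using gp unfolding gp_function_def matroid_def by blast
    then obtain es where es: "es \<in> tuples E 2" "distinct es" "?f es \<noteq> 0" unfolding gp_bases_def by blast
    then obtain a b where ab: "es = [a, b]" "a \<in> E" "b \<in> E" "a \<noteq> b"
      by (auto simp: tuples_def numeral_2_eq_2 length_Suc_conv)
    have "a \<noteq> e" "b \<noteq> e" using no es ab sw'[of a b] by auto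
    hence "three_term (?Y w [e] * ?f [a, b]) (?Y w [a] * ?f [e, b]) (?Y w [b] * ?f [e, a])"
      using rel[OF wP eE ab(2,3)] ab by auto
    moreover have "?f [e, a] = 0" "?f [e, b] = 0" using no ab by auto
    ultimately show False using Ye es ab by simp
  qed
  show prop_self: "proportional E 1 (\<lambda>xs. ?f (x # xs)) (?Y x)" if x: "x \<in> points I" for x
  proof -
    have "x \<in> span (insert x I)" using points_in_E[OF x] unfolding span_def by blast
    thus ?thesis using prop_in[OF x points_in_E[OF x]] nonloop[OF x] by blast
  qed
  have supp: "?f [e, b] \<noteq> 0 \<longleftrightarrow> e \<noteq> b \<and> e \<notin> I \<and> b \<notin> I \<and> insert e (insert b I) \<in> Bs"
    if e: "e \<in> E" and b: "b \<in> E" for e b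
  proof (cases "e \<in> points I")
    case True
    have "?f [e, b] \<noteq> 0 \<longleftrightarrow> b \<notin> span (insert e I)" by (rule prop_supp[OF prop_self[OF True] True b])
    also have "\<dots> \<longleftrightarrow> adj I e b"
      using True b unfolding span_def adj_def points_def by (auto simp: insert_commute)
    also have "\<dots> \<longleftrightarrow> e \<noteq> b \<and> e \<notin> I \<and> b \<notin> I \<and> insert e (insert b I) \<in> Bs"
      using card_insert_adj[of I e b] I Bs_iff[of "insert e (insert b I)"] unfolding adj_def by auto
    finally show ?thesis .
  next
    case False
    hence "?f [e, b] = 0" using loop[OF _ b] not_span_iff[OF e] by blast
    moreover have "insert e (insert b I) \<notin> Bs" if "e \<notin> I"
      using that False ind_mono[OF Bs_ind, of "insert e (insert b I)" "insert e I"] unfolding points_def by blast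
    ultimately show ?thesis by blast
  qed
  have s: "rk - card I = 2" using I by simp
  show "contr_gp I ?f"
    unfolding contr_gp_def s
  proof (intro conjI ballI sw)
    fix xs assume "xs \<in> tuples E 2"
    then obtain a b where ab: "xs = [a, b]" "a \<in> E" "b \<in> E"
      by (auto simp: tuples_def numeral_2_eq_2 length_Suc_conv)
    thus "?f xs \<noteq> 0 \<longleftrightarrow> distinct xs \<and> set xs \<inter> I = {} \<and> I \<union> set xs \<in> Bs"
      using supp[OF ab(2,3)] by auto
  qed (use gp in \<open>unfold gp_function_def three_term_def, blast\<close>)
qed

section \<open>Descending induction over independent sets\<close>

text \<open>State of the induction once all independent sets with at least \<open>k\<close> elements
  are treated, bases excepted. The last clause anchors coranks one and two to the very functions
  \<open>\<psi>\<close>, so that agreement there is not lost on the way down.\<close>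

definition compatible :: "('e set \<Rightarrow> 'e list \<Rightarrow> 't::tract) \<Rightarrow> nat \<Rightarrow> ('e set \<Rightarrow> 'e list \<Rightarrow> 't) \<Rightarrow> bool" where
  "compatible \<psi> k \<Phi> \<longleftrightarrow>
     (\<forall>I. ind I \<and> k \<le> card I \<and> card I < rk \<longrightarrow> contr_gp I (\<Phi> I)) \<and>
     (\<forall>I x. ind I \<and> k \<le> card I \<and> card I + 2 \<le> rk \<and> x \<in> points I \<longrightarrow>
        proportional E (rk - card I - 1) (\<lambda>xs. \<Phi> I (x # xs)) (\<Phi> (insert x I))) \<and>
     (\<forall>I. ind I \<and> rk \<le> card I + 2 \<and> card I < rk \<longrightarrow> \<Phi> I = \<psi> (span I))"

text \<open>From size \<open>rk - 2\<close> on only coranks one and two occur below a basis, also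
  when the subtraction truncates, and there the flat \<open>span I\<close> provides the
  function.\<close>

lemma compatible_start:
  assumes L: "Lambda2_representation E Bs \<psi>"
  shows "compatible \<psi> (rk - 2) (\<lambda>I. \<psi> (span I))"
  unfolding compatible_def
proof (intro conjI allI impI)
  fix I assume I: "ind I \<and> rk - 2 \<le> card I \<and> card I < rk"
  hence "card I + 1 = rk \<or> card I + 2 = rk" by linarith
  thus "contr_gp I (\<psi> (span I))" using Lambda2_corank1[OF L] Lambda2_corank2(1)[OF L] I by blast
next
  fix I x assume I: "ind I \<and> rk - 2 \<le> card I \<and> card I + 2 \<le> rk \<and> x \<in> points I"
  hence c: "card I + 2 = rk" by linarith
  hence "rk - card I - 1 = 1" by linarith
  thus "proportional E (rk - card I - 1) (\<lambda>xs. \<psi> (span I) (x # xs)) (\<psi> (span (insert x I)))"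
    using Lambda2_corank2(2)[OF L _ c] I by simp
qed simp

text \<open>Only sets of size \<open>k\<close> get new functions, by \<open>contr_gp_extend\<close>;
  \<open>k + 3 \<le> rk\<close> keeps them away from the anchored coranks.\<close>

lemma compatible_step:
  assumes \<Phi>: "compatible \<psi> (Suc k) \<Phi>" and k: "k + 3 \<le> rk"
  shows "\<exists>\<Phi>'. compatible \<psi> k \<Phi>'"
proof -
  have gp: "contr_gp I (\<Phi> I)" if "ind I" "Suc k \<le> card I" "card I < rk" for I
    using \<Phi> that unfolding compatible_def by blast
  have loc: "proportional E (rk - card I - 1) (\<lambda>xs. \<Phi> I (x # xs)) (\<Phi> (insert x I))"
    if "ind I" "Suc k \<le> card I" "card I + 2 \<le> rk" "x \<in> points I" for I x
    using \<Phi> that unfolding compatible_def by blast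
  let ?P = "\<lambda>I h. contr_gp I h \<and>
    (\<forall>u\<in>points I. proportional E (rk - card I - 1) (\<lambda>xs. h (u # xs)) (\<Phi> (insert u I)))"
  have ex: "\<exists>h. ?P I h" if I: "ind I" "card I = k" for I
  proof (rule contr_gp_extend[OF I(1)])
    show "card I + 3 \<le> rk" using k I by simp
    fix u assume u: "u \<in> points I"
    show "contr_gp (insert u I) (\<Phi> (insert u I))"
      using gp[of "insert u I"] card_insert_points[OF u] u I k unfolding points_def by auto
  next
    fix u v assume uv: "adj I u v"
    have u: "u \<in> points I" "v \<in> points (insert u I)"
      using uv adj_points[OF uv] unfolding adj_def points_def by (auto simp: insert_commute)
    have "rk - card I - 2 = rk - card (insert u I) - 1" using card_insert_points[OF u(1)] by simp
    thus "proportional E (rk - card I - 2) (\<lambda>xs. \<Phi> (insert u I) (v # xs)) (\<Phi> (insert v (insert u I)))"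
      using loc[of "insert u I" v] card_insert_points[OF u(1)] u I k unfolding points_def[of I] by auto
  qed
  define \<Phi>' where "\<Phi>' I = (if card I = k then SOME h. ?P I h else \<Phi> I)" for I
  have \<Phi>'k: "?P I (\<Phi>' I)" if I: "ind I" "card I = k" for I
    unfolding \<Phi>'_def using someI_ex[OF ex[OF I]] I by simp
  have \<Phi>'n: "\<Phi>' I = \<Phi> I" if "card I \<noteq> k" for I unfolding \<Phi>'_def using that by simp
  have "compatible \<psi> k \<Phi>'"
    unfolding compatible_def
  proof (intro conjI allI impI)
    fix I assume I: "ind I \<and> k \<le> card I \<and> card I < rk"
    show "contr_gp I (\<Phi>' I)"
      using \<Phi>'k[of I] \<Phi>'n[of I] gp[of I] I by (cases "card I = k") auto
  next
    fix I x assume I: "ind I \<and> k \<le> card I \<and> card I + 2 \<le> rk \<and> x \<in> points I"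
    have "\<Phi>' (insert x I) = \<Phi> (insert x I)" using \<Phi>'n card_insert_points[of x I] I by simp
    thus "proportional E (rk - card I - 1) (\<lambda>xs. \<Phi>' I (x # xs)) (\<Phi>' (insert x I))"
      using \<Phi>'k[of I] \<Phi>'n[of I] loc[of I x] I by (cases "card I = k") auto
  next
    fix I assume I: "ind I \<and> rk \<le> card I + 2 \<and> card I < rk"
    hence "card I \<noteq> k" using k by linarith
    thus "\<Phi>' I = \<psi> (span I)" using \<Phi>'n[of I] \<Phi> I unfolding compatible_def by auto
  qed
  thus ?thesis by blast
qed

lemma compatible_family:
  assumes L: "Lambda2_representation E Bs \<psi>"
  shows "\<exists>\<Phi>. compatible \<psi> 0 \<Phi>"
proof (rule inc_induct[of 0 "rk - 2"])
  show "\<exists>\<Phi>. compatible \<psi> (rk - 2) \<Phi>" using compatible_start[OF L] by blast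
  show "\<exists>\<Phi>. compatible \<psi> n \<Phi>" if "n < rk - 2" "\<exists>\<Phi>. compatible \<psi> (Suc n) \<Phi>" for n
    using compatible_step[of \<psi> n] that by auto
qed simp

text \<open>The linking clause of \<open>compatible\<close> is applied once for each entry as the
  prefix grows, and the scalars multiply.\<close>

lemma compatible_append:
  assumes \<Phi>: "compatible \<psi> 0 \<Phi>"
  shows "distinct xs \<Longrightarrow> ind (set xs) \<Longrightarrow> length xs < rk \<Longrightarrow>
    proportional E (rk - length xs) (\<lambda>zs. \<Phi> {} (xs @ zs)) (\<Phi> (set xs))"
proof (induction xs rule: rev_induct)
  case Nil
  thus ?case by (simp add: proportional_refl)
next
  case (snoc x xs)
  have ind: "ind (set xs)" using snoc.prems ind_mono[of "set (xs @ [x])" "set xs"] by auto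
  have x: "x \<in> points (set xs)" using snoc.prems unfolding points_def by auto
  have card: "card (set xs) = length xs" using snoc.prems by (simp add: distinct_card)
  have s: "rk - length xs = Suc (rk - length (xs @ [x]))" using snoc.prems by simp
  obtain a where a: "a \<noteq> 0"
    "\<And>zs. zs \<in> tuples E (rk - length xs) \<Longrightarrow> \<Phi> {} (xs @ zs) = a * \<Phi> (set xs) zs"
    using snoc.IH snoc.prems ind unfolding proportional_def by auto
  have "proportional E (rk - length (xs @ [x])) (\<lambda>zs. \<Phi> {} ((xs @ [x]) @ zs)) (\<lambda>zs. \<Phi> (set xs) (x # zs))"
    unfolding proportional_def using a(1) a(2)[of "x # _"] points_in_E[OF x] unfolding s
    by (intro exI[of _ a]) simp
  also have "rk - length (xs @ [x]) = rk - card (set xs) - 1" using card by simp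
  also have "proportional E (rk - card (set xs) - 1) (\<lambda>zs. \<Phi> (set xs) (x # zs)) (\<Phi> (insert x (set xs)))"
  proof -
    have "card (set xs) + 2 \<le> rk" using snoc.prems card by simp
    thus ?thesis using \<Phi> ind x unfolding compatible_def by blast
  qed
  finally show ?case using card by simp
qed

section \<open>Quotients by flats through chosen ordered bases\<close>

text \<open>The same choice as inside \<open>F_quotient\<close>, given a name so that quotients can
  be written as values of \<open>\<phi>\<close> with a fixed prefix.\<close>

definition ordered_basis :: "'e set \<Rightarrow> 'e list" where
  "ordered_basis F = (SOME is. distinct is \<and> basis_of Bs F (set is))"

lemma ordered_basis:
  assumes "F \<in> flats E Bs"
  shows "distinct (ordered_basis F)" "ind (set (ordered_basis F))" "span (set (ordered_basis F)) = F"
    and "corank E Bs F = rk - length (ordered_basis F)"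
proof -
  obtain I where I: "basis_of Bs F I" using flat_basis[OF assms] .
  obtain xs where xs: "set xs = I" "distinct xs"
    using finite_distinct_list[OF finite_ind[OF basis_of_indep[OF I]]] by blast
  have *: "distinct (ordered_basis F) \<and> basis_of Bs F (set (ordered_basis F))"
    unfolding ordered_basis_def by (rule someI[of _ xs]) (use I xs in simp)
  thus 1: "distinct (ordered_basis F)" "ind (set (ordered_basis F))" "span (set (ordered_basis F)) = F"
    using flat_eq_span[OF assms] basis_of_indep by auto
  show "corank E Bs F = rk - length (ordered_basis F)"
    using corank_span[OF 1(2)] 1 by (simp add: distinct_card)
qed

lemma F_quotient_eq:
  "gp_bases E r \<phi> = Bs \<Longrightarrow>
    F_quotient E r \<phi> F = (\<lambda>es\<in>tuples E (corank E Bs F). \<phi> (ordered_basis F @ es))"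
  unfolding F_quotient_def ordered_basis_def Let_def by simp

lemma flats_le2D:
  assumes "F \<in> flats_le2 E Bs"
  shows "F \<in> flats E Bs" "length (ordered_basis F) < rk" "rk \<le> length (ordered_basis F) + 2"
  using assms ordered_basis(4)[of F] unfolding flats_le2_def by auto

lemma hyperplane_flats_le2: "H \<in> hyperplanes E Bs \<Longrightarrow> H \<in> flats_le2 E Bs"
  unfolding hyperplanes_def flats_le2_def by blast

section \<open>Existence, uniqueness and the converse\<close>

text \<open>The function is the member of a compatible family at the empty set. With an ordered
  basis of \<open>F\<close> as prefix it is a multiple of the member at that basis, which is
  anchored to \<open>\<psi> F\<close>.\<close>

lemma Lambda2_imp_gp_function:
  fixes \<psi> :: "'e set \<Rightarrow> 'e list \<Rightarrow> 't::tract"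
  assumes L: "Lambda2_representation E Bs \<psi>"
  shows "\<exists>\<phi>. gp_function E rk \<phi> \<and> gp_bases E rk \<phi> = Bs \<and> agrees_with_quotients E Bs \<psi> \<phi>"
proof -
  obtain \<Phi> where \<Phi>: "compatible \<psi> 0 \<Phi>" using compatible_family[OF L] by blast
  \<comment> \<open>In rank zero a compatible family says nothing about the empty set, which is a
    basis; a constant unit supplies the function.\<close>
  define \<phi>0 where "\<phi>0 = (if rk = 0 then (\<lambda>_. 1) else \<Phi> {})"
  define \<phi> where "\<phi> = restrict \<phi>0 (tuples E rk)"
  have gp0: "contr_gp {} \<phi>0"
  proof (cases "rk = 0")
    case True
    hence "{} \<in> Bs" using Bs_iff ind_empty by simp
    thus ?thesis unfolding contr_gp_def swap_neg_def \<phi>0_def using True by (auto simp: tuples_def)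
  next
    case False
    thus ?thesis using \<Phi> ind_empty unfolding compatible_def \<phi>0_def by simp
  qed
  have gp: "gp_function E rk \<phi>" and bases: "gp_bases E rk \<phi> = Bs"
    using contr_gp_gp_function[OF gp0 ind_empty] contr_gp_bases[OF gp0 ind_empty]
    by (simp_all add: \<phi>_def)
  have "gp_class E (corank E Bs F) (\<psi> F) = gp_class E (corank E Bs F) (F_quotient E rk \<phi> F)"
    if F: "F \<in> flats_le2 E Bs" for F
  proof -
    note F' = flats_le2D[OF F] and ob = ordered_basis[OF flats_le2D(1)[OF F]]
    let ?xs = "ordered_basis F"
    have "card (set ?xs) = length ?xs" using ob by (simp add: distinct_card)
    hence "\<Phi> (set ?xs) = \<psi> F" using \<Phi> ob F' unfolding compatible_def by auto
    hence "proportional E (corank E Bs F) (\<lambda>zs. \<Phi> {} (?xs @ zs)) (\<psi> F)"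
      using compatible_append[OF \<Phi> ob(1,2) F'(2)] ob(4) by simp
    moreover have "\<phi> (?xs @ zs) = \<Phi> {} (?xs @ zs)" if "zs \<in> tuples E (corank E Bs F)" for zs
    proof -
      have "?xs @ zs \<in> tuples E rk"
        using that ob(4) F'(2) ind_subset_E[OF ob(2)] by (auto simp: tuples_def)
      thus ?thesis using F'(2) by (simp add: \<phi>_def \<phi>0_def)
    qed
    ultimately have "proportional E (corank E Bs F) (F_quotient E rk \<phi> F) (\<psi> F)"
      unfolding F_quotient_eq[OF bases] proportional_def by simp
    from proportional_gp_class[OF this] show ?thesis by simp
  qed
  thus ?thesis using gp bases unfolding agrees_with_quotients_def by blast
qed

text \<open>Agreement on a hyperplane speaks of its chosen ordered basis;
  \<open>contr_gp_hyperplane\<close> carries it to every ordered basis, as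
  \<open>contr_gp_unique\<close> requires.\<close>

lemma agrees_with_quotients_unique:
  assumes gp: "gp_function E rk \<phi>" "gp_bases E rk \<phi> = Bs" "agrees_with_quotients E Bs \<psi> \<phi>"
    and gp': "gp_function E rk \<phi>'" "gp_bases E rk \<phi>' = Bs" "agrees_with_quotients E Bs \<psi> \<phi>'"
  shows "gp_class E rk \<phi> = gp_class E rk \<phi>'"
proof -
  note f = gp_function_contr_gp[OF gp(1,2)] and g = gp_function_contr_gp[OF gp'(1,2)]
  have "proportional E 1 (\<lambda>zs. \<phi> (xs @ zs)) (\<lambda>zs. \<phi>' (xs @ zs))"
    if xs: "distinct xs" "ind (set xs)" "length xs + 1 = rk" for xs
  proof -
    have card: "card (set xs) + 1 = rk" using xs by (simp add: distinct_card)
    hence H: "span (set xs) \<in> hyperplanes E Bs" using hyperplane_iff xs by blast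
    hence H1: "corank E Bs (span (set xs)) = 1" "span (set xs) \<in> flats E Bs"
      unfolding hyperplanes_def by auto
    let ?ys = "ordered_basis (span (set xs))"
    note ob = ordered_basis[OF H1(2)]
    have ys: "distinct ?ys" "length ?ys + 1 = rk" "ind (set ?ys)" "set ?ys \<subseteq> span (set xs)"
      using ob H1 ind_subset_E[OF ob(2)] unfolding span_def by auto
    have "gp_class E 1 (F_quotient E rk \<phi> (span (set xs))) = gp_class E 1 (F_quotient E rk \<phi>' (span (set xs)))"
      using gp(3) gp'(3) hyperplane_flats_le2[OF H] H1 unfolding agrees_with_quotients_def by metis
    from gp_class_proportional[OF this]
    have eq: "proportional E 1 (\<lambda>zs. \<phi> (?ys @ zs)) (\<lambda>zs. \<phi>' (?ys @ zs))"
      unfolding F_quotient_eq[OF gp(2)] F_quotient_eq[OF gp'(2)] H1 by simp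
    have "proportional E 1 (\<lambda>zs. \<phi> (xs @ zs)) (\<lambda>zs. \<phi> (?ys @ zs))"
      by (rule contr_gp_hyperplane[OF f ys(1-3) xs(1,3,2) ys(4)])
    also note eq
    also have "proportional E 1 (\<lambda>zs. \<phi>' (?ys @ zs)) (\<lambda>zs. \<phi>' (xs @ zs))"
      by (rule proportional_sym[OF contr_gp_hyperplane[OF g ys(1-3) xs(1,3,2) ys(4)]])
    finally show ?thesis .
  qed
  from contr_gp_unique[OF f g this] show ?thesis by (rule proportional_gp_class)
qed

text \<open>The quotients by a corank-two flat and by a hyperplane containing it can be formed, up
  to scalars, with nested bases \<open>is\<close> and \<open>is @ [x]\<close>. (\<Lambda>R2) is then
  (GP3) with the entries \<open>is\<close> and \<open>x\<close> fixed.\<close>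

lemma F_quotients_Lambda2:
  assumes gp: "gp_function E rk \<phi>" "gp_bases E rk \<phi> = Bs"
  shows "Lambda2_representation E Bs (F_quotient E rk \<phi>)"
proof -
  note f = gp_function_contr_gp[OF gp]
  have con: "contr_gp (set (ordered_basis F)) (\<lambda>zs. \<phi> (ordered_basis F @ zs))"
    "card (set (ordered_basis F)) = length (ordered_basis F)" if "F \<in> flats E Bs" for F
    using contr_gp_append[OF f, of "ordered_basis F"] ordered_basis[OF that] by (auto simp: distinct_card)
  have gpF: "gp_function E (corank E Bs F) (F_quotient E rk \<phi> F)" if F: "F \<in> flats E Bs" for F
    using contr_gp_gp_function[OF con(1)[OF F] ordered_basis(2)[OF F]] ordered_basis(4)[OF F] con(2)[OF F]
    unfolding F_quotient_eq[OF gp(2)] by simp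
  have hyp: "hyperplane_function E H (\<lambda>e\<in>E. F_quotient E rk \<phi> H [e])" if "H \<in> hyperplanes E Bs" for H
  proof -
    have H: "H \<in> flats E Bs" "corank E Bs H = 1" using that unfolding hyperplanes_def by auto
    note ob = ordered_basis[OF H(1)]
    let ?I = "set (ordered_basis H)"
    have c: "card ?I + 1 = rk" using ob(4) H(2) con(2)[OF H(1)] by simp
    have "F_quotient E rk \<phi> H [e] \<noteq> 0 \<longleftrightarrow> e \<notin> H" if e: "e \<in> E" for e
    proof -
      have "F_quotient E rk \<phi> H [e] = \<phi> (ordered_basis H @ [e])"
        unfolding F_quotient_eq[OF gp(2)] H(2) using e by (simp add: tuples_def)
      also have "\<dots> \<noteq> 0 \<longleftrightarrow> e \<notin> ?I \<and> insert e ?I \<in> Bs"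
        using contr_gp_nonzero[OF con(1)[OF H(1)], of "[e]"] c e by (auto simp: tuples_def)
      also have "\<dots> \<longleftrightarrow> e \<in> points ?I"
        using card_insert_points[of e ?I] c Bs_iff[of "insert e ?I"] unfolding points_def by auto
      also have "\<dots> \<longleftrightarrow> e \<notin> H" using not_span_iff[OF e, of ?I] ob(3) by simp
      finally show ?thesis .
    qed
    thus ?thesis unfolding hyperplane_function_def by auto
  qed
  have quot: "matroid_quotient E 1 (F_quotient E rk \<phi> H) 2 (F_quotient E rk \<phi> F)"
    if F: "F \<in> flats E Bs" "corank E Bs F = 2" and "H \<in> hyperplanes E Bs" and FH: "F \<subseteq> H" for F H
  proof -
    have H: "H \<in> flats E Bs" "corank E Bs H = 1" using that(3) unfolding hyperplanes_def by auto
    note obF = ordered_basis[OF F(1)] and obH = ordered_basis[OF H(1)]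
    let ?is = "ordered_basis F" and ?js = "ordered_basis H"
    have len: "length ?is + 2 = rk" "length ?js + 1 = rk" using obF(4) obH(4) F H by auto
    have "card (set ?is) < card (set ?js)" using con(2)[OF F(1)] con(2)[OF H(1)] len by simp
    then obtain x where x: "x \<in> set ?js" "x \<notin> set ?is" "ind (insert x (set ?is))"
      using ind_augment[OF obF(2) obH(2)] by blast
    have sub: "set ?is \<subseteq> F" "set ?js \<subseteq> H"
      using basis_of_span[OF obF(2)] basis_of_span[OF obH(2)] obF(3) obH(3) unfolding basis_of_def by auto
    \<comment> \<open>The chosen bases of \<open>F\<close> and \<open>H\<close> need not be nested,
      so that of \<open>H\<close> is replaced, up to a scalar, by one extending that of
      \<open>F\<close>.\<close>
    have "proportional E 1 (\<lambda>zs. \<phi> (?js @ zs)) (\<lambda>zs. \<phi> ((?is @ [x]) @ zs))"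
      by (rule contr_gp_hyperplane[OF f]) (use x sub FH len obF obH in auto)
    then obtain k where k: "k \<noteq> 0" "\<And>zs. zs \<in> tuples E 1 \<Longrightarrow> \<phi> (?js @ zs) = k * \<phi> ((?is @ [x]) @ zs)"
      unfolding proportional_def by blast
    have \<psi>H: "F_quotient E rk \<phi> H [a] = k * \<phi> (?is @ [x, a])" if "a \<in> E" for a
      unfolding F_quotient_eq[OF gp(2)] H(2) using k(2)[of "[a]"] that by (simp add: tuples_def)
    have \<psi>F: "F_quotient E rk \<phi> F [a, b] = \<phi> (?is @ [a, b])" if "a \<in> E" "b \<in> E" for a b
      unfolding F_quotient_eq[OF gp(2)] F(2) using that by (simp add: tuples_def)
    have xE: "x \<in> E" "set ?is \<subseteq> E" using ind_subset_E[OF x(3)] by auto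
    have gpH: "gp_function E 1 (F_quotient E rk \<phi> H)" using gpF[OF H(1)] H(2) by simp
    have "swap_neg E 2 (F_quotient E rk \<phi> F)" using gp_function_swap_neg[OF gpF[OF F(1)]] F(2) by simp
    from matroid_quotient_rank1[OF finite_E gpH this] show ?thesis
      using contr_gp_three_term[OF f, of ?is x] len xE
      by (simp add: \<psi>H \<psi>F mult.assoc three_term_scale[OF k(1)])
  qed
  show ?thesis
    unfolding Lambda2_representation_def using gpF hyp quot unfolding flats_le2_def by blast
qed

end

theorem theorem2p7:
  fixes E :: "'e set" and Bs :: "'e set set" and r :: nat
  assumes perfect: "perfect_tract TYPE('t::tract)"
    and M: "matroid E Bs"
    and r: "r = mrank Bs E"
  shows "(\<forall>\<psi> :: 'e set \<Rightarrow> 'e list \<Rightarrow> 't. Lambda2_representation E Bs \<psi> \<longrightarrow>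
            (\<exists>!\<Phi>. \<exists>\<phi>. gp_function E r \<phi> \<and> gp_bases E r \<phi> = Bs \<and> \<Phi> = gp_class E r \<phi> \<and>
                       agrees_with_quotients E Bs \<psi> \<phi>)) \<and>
         (\<forall>\<phi> :: 'e list \<Rightarrow> 't. gp_function E r \<phi> \<and> gp_bases E r \<phi> = Bs \<longrightarrow>
            (\<exists>\<psi>. Lambda2_representation E Bs \<psi> \<and> agrees_with_quotients E Bs \<psi> \<phi>) \<and>
            (\<forall>\<psi> \<psi>'. Lambda2_representation E Bs \<psi> \<and> agrees_with_quotients E Bs \<psi> \<phi> \<and>
                     Lambda2_representation E Bs \<psi>' \<and> agrees_with_quotients E Bs \<psi>' \<phi> \<longrightarrow>
               (\<exists>a. \<forall>F\<in>flats_le2 E Bs.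
                  a F \<noteq> 0 \<and> \<psi>' F = gp_scale E (corank E Bs F) (a F) (\<psi> F))))"
proof -
  interpret basis_matroid E Bs by unfold_locales (rule M)
  show ?thesis
    unfolding r
  proof (intro conjI allI impI)
    fix \<psi> :: "'e set \<Rightarrow> 'e list \<Rightarrow> 't"
    assume "Lambda2_representation E Bs \<psi>"
    then obtain \<phi> where "gp_function E rk \<phi>" "gp_bases E rk \<phi> = Bs" "agrees_with_quotients E Bs \<psi> \<phi>"
      using Lambda2_imp_gp_function by blast
    thus "\<exists>!\<Phi>. \<exists>\<phi>. gp_function E rk \<phi> \<and> gp_bases E rk \<phi> = Bs \<and> \<Phi> = gp_class E rk \<phi> \<and>
        agrees_with_quotients E Bs \<psi> \<phi>"
      using agrees_with_quotients_unique by (intro ex1I[of _ "gp_class E rk \<phi>"]) blast+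
  next
    fix \<phi> :: "'e list \<Rightarrow> 't"
    assume \<phi>: "gp_function E rk \<phi> \<and> gp_bases E rk \<phi> = Bs"
    have "agrees_with_quotients E Bs (F_quotient E rk \<phi>) \<phi>"
      unfolding agrees_with_quotients_def by simp
    thus "\<exists>\<psi>. Lambda2_representation E Bs \<psi> \<and> agrees_with_quotients E Bs \<psi> \<phi>"
      using F_quotients_Lambda2 \<phi> by blast
  next
    fix \<phi> :: "'e list \<Rightarrow> 't" and \<psi> \<psi>'
    assume *: "Lambda2_representation E Bs \<psi> \<and> agrees_with_quotients E Bs \<psi> \<phi> \<and>
      Lambda2_representation E Bs \<psi>' \<and> agrees_with_quotients E Bs \<psi>' \<phi>"
    have "\<exists>a. a \<noteq> 0 \<and> \<psi>' F = gp_scale E (corank E Bs F) a (\<psi> F)" if F: "F \<in> flats_le2 E Bs" for F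
    proof -
      have "gp_class E (corank E Bs F) (\<psi>' F) = gp_class E (corank E Bs F) (\<psi> F)"
        using * F unfolding agrees_with_quotients_def by simp
      from gp_class_proportional[OF this] obtain a where a: "a \<noteq> 0"
        "\<And>xs. xs \<in> tuples E (corank E Bs F) \<Longrightarrow> \<psi>' F xs = a * \<psi> F xs"
        unfolding proportional_def by blast
      have "Lambda2_representation E Bs \<psi>'" using * by blast
      hence "gp_function E (corank E Bs F) (\<psi>' F)"
        using F unfolding Lambda2_representation_def by simp
      \<comment> \<open>Extensionality of \<open>\<psi>' F\<close> turns proportionality on tuples
        into equality of functions.\<close>
      hence ext: "\<psi>' F \<in> extensional (tuples E (corank E Bs F))"
        unfolding gp_function_def by (simp add: PiE_def)
      have "\<psi>' F = gp_scale E (corank E Bs F) a (\<psi> F)"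
        by (rule extensionalityI[OF ext]) (auto simp: gp_scale_def a)
      thus ?thesis using a by blast
    qed
    thus "\<exists>a. \<forall>F\<in>flats_le2 E Bs. a F \<noteq> 0 \<and> \<psi>' F = gp_scale E (corank E Bs F) (a F) (\<psi> F)"
      by (intro bchoice ballI)
  qed
qed

end
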